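(* Let $n\ge2$ and $0<\alpha_0<1$. There exist a bounded closed set $E_{\alpha_0}\subset\mathbb R^n$ with $\overline{\dim}_L E_{\alpha_0}=n-2\alpha_0$ and a quasiconformal, Lipschitz mapping $f:\mathbb R^n\to\mathbb R^n$ with $J_f\in A_1(\mathbb R^n;E_{\alpha_0})$ for which ${\bf C}_f$ is not bounded on $Q_\alpha(\mathbb R^n)$ for any $\alpha\in(\alpha_0,1)$.
   Context: Quasiconformal: a homeomorphism $f:\mathbb R^n\to\mathbb R^n$, $n\ge2$, is quasiconformal if $f\in W^{1,1}_{\rm loc}(\mathbb R^n;\mathbb R^n)$ and there is $K\ge1$ with $|Df(x)|^n\le K J_f(x)$ for a.e. $x\in\mathbb R^n$, where $J_f$ is the Jacobian determinant of $f$. $Q$-spaces: for $\alpha\in(0,1)$, $Q_\alpha(\mathbb R^n)$ consists of all $u\in L^2_{\rm loc}(\mathbb R^n)$ with $$\|u\|_{Q_\alpha(\mathbb R^n)}=\sup_{x_0\in\mathbb R^n,\,r>0}\left(r^{2\alpha-n}\int_{B(x_0,r)}\int_{B(x_0,r)}\frac{|u(x)-u(y)|^2}{|x-y|^{n+2\alpha}}\,dx\,dy\right)^{1/2}<\infty .$$ Composition operator: ${\bf C}_f(u)=u\circ f$. It is bounded on $Q_\alpha(\mathbb R^n)$ if there is a constant $C$ such that $u\circ f\in Q_\alpha(\mathbb R^n)$ and $\|u\circ f\|_{Q_\alpha(\mathbb R^n)}\le C\|u\|_{Q_\alpha(\mathbb R^n)}$ for all $u\in Q_\alpha(\mathbb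 R^n)$. Local Muckenhoupt class: for a closed set $E\subseteq\mathbb R^n$ and a nonnegative function $w:\mathbb R^n\to\mathbb R$, $w\in A_1(\mathbb R^n;E)$ means there is a constant $C>0$ such that $$\frac1{|B|}\int_B w(z)\,dz\le C\,\operatorname*{ess\,inf}_{x\in B}w(x)$$ for every ball $B=B(x_B,r_B)\subset\mathbb R^n$ with $2r_B<d(x_B,E)$, where $d(x,E)=\inf_{z\in E}|x-z|$. Dimension: for $F\subseteq\mathbb R^n$ and $r>0$, $N_{\rm cov}(r,F)$ is the minimal number of cubes of edge length $r$ required to cover $F$ (with $\log0=-\infty$). The local self-similar Minkowski dimension of $E$ is $$\overline{\dim}_L E=\liminf_{N\to\infty}\ \limsup_{r\to0}\ \sup_{B:\ Nr\le r_B\le1}\frac{\log N_{\rm cov}(r,E\cap B)}{\log(r_B/r)},$$ the supremum being over all balls $B=B(x_B,r_B)\subset\mathbb R^n$ with $r_B\in[Nr,1]$. *)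

theory Defs
  imports "HOL-Analysis.Analysis" "HOL-Library.Extended_Nat"
begin

text \<open>Membership in $C^k$, for a real-valued function on the whole space.\<close>

primrec Ck :: "nat \<Rightarrow> ('a::euclidean_space \<Rightarrow> real) \<Rightarrow> bool" where
  "Ck 0 \<phi> \<longleftrightarrow> continuous_on UNIV \<phi>"
| "Ck (Suc k) \<phi> \<longleftrightarrow> (\<forall>x. \<phi> differentiable (at x)) \<and>
     (\<forall>v. Ck k (\<lambda>x. frechet_derivative \<phi> (at x) v))"

definition test_function :: "('a::euclidean_space \<Rightarrow> real) \<Rightarrow> bool" where
  "test_function \<phi> \<longleftrightarrow> (\<forall>k. Ck k \<phi>) \<and> compact (closure {x. \<phi> x \<noteq> 0})"

definition locally_integrable ::
    "('a::euclidean_space \<Rightarrow> 'b::{banach, second_countable_topology}) \<Rightarrow> bool" where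
  "locally_integrable f \<longleftrightarrow> (\<forall>K. compact K \<longrightarrow> set_integrable lebesgue K f)"

text \<open>
  \<open>W11_loc_derivative f Df\<close> says that $f \in W^{1,1}_{\mathrm{loc}}$ and that \<open>Df\<close> is (a version of)
  its weak derivative, with entry \<open>Df x $ i $ j\<close> equal to $\partial_j f_i(x)$. A weak derivative is
  determined only up to null sets, hence a relation and not a function of \<open>f\<close>; everything stated
  below about \<open>Df\<close> is insensitive to changes on null sets.
\<close>

definition W11_loc_derivative ::
    "(real^'n::finite \<Rightarrow> real^'n) \<Rightarrow> (real^'n \<Rightarrow> real^'n^'n) \<Rightarrow> bool" where
  "W11_loc_derivative f Df \<longleftrightarrow>
     locally_integrable f \<and> locally_integrable Df \<and>
     (\<forall>\<phi>. test_function \<phi> \<longrightarrow> (\<forall>i j.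
        (LINT x|lebesgue. f x $ i * frechet_derivative \<phi> (at x) (axis j 1)) =
        - (LINT x|lebesgue. Df x $ i $ j * \<phi> x)))"

definition quasiconformal :: "(real^'n::finite \<Rightarrow> real^'n) \<Rightarrow> bool" where
  "quasiconformal f \<longleftrightarrow>
     (\<exists>g. homeomorphism UNIV UNIV f g) \<and>
     (\<exists>Df. W11_loc_derivative f Df \<and>
        (\<exists>K\<ge>1. AE x in lebesgue. onorm ((*v) (Df x)) ^ CARD('n) \<le> K * det (Df x)))"

text \<open>
  The essential infimum is dual to the constant \<open>esssup\<close> of HOL-Probability. Nonnegativity is only
  required almost everywhere because the class is applied to Jacobians of weak derivatives.
  The distance to the empty set is infinite, whereas \<open>infdist x {} = 0\<close>.
\<close>

definition muckenhoupt_A1 :: "(real^'n::finite) set \<Rightarrow> (real^'n \<Rightarrow> real) \<Rightarrow> bool" where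
  "muckenhoupt_A1 E w \<longleftrightarrow>
     w \<in> borel_measurable lebesgue \<and> (AE x in lebesgue. 0 \<le> w x) \<and>
     (\<exists>C>0::real. \<forall>x r. 0 < r \<and> (E = {} \<or> 2 * r < infdist x E) \<longrightarrow>
        (\<integral>\<^sup>+z\<in>ball x r. ennreal (w z) \<partial>lebesgue) / emeasure lebesgue (ball x r)
          \<le> ennreal C * Liminf (ae_filter (restrict_space lebesgue (ball x r))) (\<lambda>z. ennreal (w z)))"

definition L2_loc :: "(real^'n::finite \<Rightarrow> real) \<Rightarrow> bool" where
  "L2_loc u \<longleftrightarrow> u \<in> borel_measurable lebesgue \<and> locally_integrable (\<lambda>x. (u x)\<^sup>2)"

definition sqrt_ennreal :: "ennreal \<Rightarrow> ennreal" where
  "sqrt_ennreal a = (if a = \<infinity> then \<infinity> else ennreal (sqrt (enn2real a)))"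

text \<open>On the diagonal, a null set, the integrand below is \<open>0 / 0 = 0\<close>.\<close>

definition Q_norm :: "real \<Rightarrow> (real^'n::finite \<Rightarrow> real) \<Rightarrow> ennreal" where
  "Q_norm \<alpha> u = (SUP (x0, r) \<in> UNIV \<times> {0<..}. sqrt_ennreal (
     ennreal (r powr (2 * \<alpha> - real CARD('n))) *
     (\<integral>\<^sup>+x\<in>ball x0 r. (\<integral>\<^sup>+y\<in>ball x0 r.
        ennreal (\<bar>u x - u y\<bar>\<^sup>2 / norm (x - y) powr (real CARD('n) + 2 * \<alpha>))
      \<partial>lebesgue) \<partial>lebesgue)))"

definition Q_space :: "real \<Rightarrow> (real^'n::finite \<Rightarrow> real) set" where
  "Q_space \<alpha> = {u. L2_loc u \<and> Q_norm \<alpha> u < \<infinity>}"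

definition composition_bounded_on_Q :: "real \<Rightarrow> (real^'n::finite \<Rightarrow> real^'n) \<Rightarrow> bool" where
  "composition_bounded_on_Q \<alpha> f \<longleftrightarrow>
     (\<exists>C::real. \<forall>u\<in>Q_space \<alpha>. u \<circ> f \<in> Q_space \<alpha> \<and> Q_norm \<alpha> (u \<circ> f) \<le> ennreal C * Q_norm \<alpha> u)"

text \<open>Cubes are closed and axis-parallel, given by their lower corner \<open>a\<close> and edge length \<open>r\<close>.\<close>

definition cube :: "real^'n::finite \<Rightarrow> real \<Rightarrow> (real^'n) set" where
  "cube a r = cbox a (\<chi> i. a $ i + r)"

definition N_cov :: "real \<Rightarrow> (real^'n::finite) set \<Rightarrow> enat" where
  "N_cov r F = (INF A \<in> {A. finite A \<and> F \<subseteq> (\<Union>a\<in>A. cube a r)}. enat (card A))"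

definition log_enat :: "enat \<Rightarrow> ereal" where
  "log_enat m = (case m of enat k \<Rightarrow> if k = 0 then - \<infinity> else ereal (ln (real k)) | \<infinity> \<Rightarrow> \<infinity>)"

definition minkowski_dim_L :: "(real^'n::finite) set \<Rightarrow> ereal" where
  "minkowski_dim_L E =
     liminf (\<lambda>N::nat. Limsup (at_right 0) (\<lambda>r::real.
       SUP (x, R) \<in> {(x, R). real N * r \<le> R \<and> R \<le> 1}.
         log_enat (N_cov r (E \<inter> ball x R)) / ereal (ln (R / r))))"

end

theory Submission
  imports Defs
begin

text \<open>
  Let \<open>d = n - 2 * \<alpha>0\<close> and choose \<open>l < 1/2\<close> with \<open>l powr (- d) = 2 ^ n\<close>. The self-similar
  Cantor set of dimension \<open>d\<close> in a cube has \<open>2 ^ (n * m)\<close> cubes of generation \<open>m\<close>; each of them has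
  a hole at its center, of size comparable to \<open>l ^ m\<close>. The set \<open>E\<close> is the closure of the set of
  centers of the cubes of all generations, and \<open>f\<close> is the identity except for the radial map
  \<open>v \<mapsto> (norm v / \<rho>) *\<^sub>R v\<close> in disjoint balls of radius \<open>\<rho>\<close> comparable to \<open>l ^ m\<close> around the centers.

  For \<open>\<alpha> > \<alpha>0\<close> take the sum of the \<open>2 ^ (n * m)\<close> bumps of radius \<open>t\<close> at the centers of
  generation \<open>m\<close>. Its squared norm in \<open>Q \<alpha>\<close> is at most a constant times
  \<open>max 1 (2 ^ (n * m) * t powr (n - 2 * \<alpha>))\<close>, which is bounded if the second term is normalised
  to be \<open>1\<close>. The map \<open>f\<close> enlarges the radius of the bumps to \<open>s = sqrt (\<rho> * t)\<close>, and
  \<open>2 ^ (n * m) * s powr (n - 2 * \<alpha>)\<close> grows exponentially in \<open>m\<close>.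
\<close>

section \<open>Radial stretching\<close>

text \<open>The energy of one bump of radius \<open>t\<close> scales like
  \<open>t powr (n - 2 * \<alpha>)\<close> and competes with the number
  \<open>l powr (- (m * d))\<close> of bumps; \<open>\<alpha> > \<alpha>0\<close> says exactly that
  \<open>n - 2 * \<alpha> < d\<close>. The normalisation therefore makes \<open>t\<close> of order
  \<open>l powr (m * d / (n - 2 * \<alpha>))\<close>, far below the radius \<open>\<rho>\<close> for
  large \<open>m\<close>, and this is what leaves room for \<open>s\<close> between the two. The map
  does not depend on \<open>\<alpha>\<close>; only the test functions do, so one \<open>f\<close>
  serves all exponents. \<open>E\<close> must contain every center: the Jacobian vanishes there, so
  its essential infimum is 0 on each ball around a center while its mean is positive. Adding the
  centers to the Cantor set costs only a constant factor in the covering numbers, since centers of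
  generation beyond \<open>m\<close> lie in the cubes of generation \<open>m\<close> and the earlier
  ones form a geometric sum. The delicate point in the upper bound is that it has to hold on balls
  of every position and radius. This requires a count of the centers in an arbitrary ball, not only
  their total number.\<close>

definition radial_matrix :: "real^'n::finite \<Rightarrow> real^'n^'n" where
  "radial_matrix v = (\<chi> i j. (if i = j then norm v else 0) + v $ i * v $ j / norm v)"

text \<open>Shows the eigenvalues: \<open>2 * norm v\<close> in the direction of \<open>v\<close>
  and \<open>norm v\<close> on its orthogonal complement. Their bounded ratio is the source of
  quasiconformality.\<close>

lemma radial_matrix_mult:
  "radial_matrix v *v w = norm v *\<^sub>R w + ((v \<bullet> w) / norm v) *\<^sub>R v"
proof -
  have "(\<Sum>j\<in>UNIV. ((if i = j then norm v else 0) + v $ i * v $ j / norm v) * w $ j)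
    = norm v * w $ i + (\<Sum>j\<in>UNIV. v $ j * w $ j) / norm v * v $ i" for i
  proof -
    have "(\<Sum>j\<in>UNIV. ((if i = j then norm v else 0) + v $ i * v $ j / norm v) * w $ j)
      = (\<Sum>j\<in>UNIV. (if i = j then norm v * w $ j else 0)) + (\<Sum>j\<in>UNIV. v $ j * w $ j * (v $ i / norm v))"
      unfolding sum.distrib[symmetric] by (rule sum.cong) (auto simp: field_simps)
    then show ?thesis
      by (simp add: sum_divide_distrib sum_distrib_left sum_distrib_right mult.commute)
  qed
  then show ?thesis
    by (simp add: vec_eq_iff radial_matrix_def matrix_vector_mult_def inner_vec_def)
qed

lemma has_derivative_norm_scaleR:
  assumes "v \<noteq> 0"
  shows "((\<lambda>x. norm x *\<^sub>R x) has_derivative (*v) (radial_matrix v)) (at v)"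
proof -
  have "((\<lambda>x. norm x *\<^sub>R x) has_derivative (\<lambda>h. norm v *\<^sub>R h + (h \<bullet> sgn v) *\<^sub>R v)) (at v)"
    using has_derivative_scaleR[OF has_derivative_norm[OF assms] has_derivative_ident] by simp
  moreover have "(*v) (radial_matrix v) = (\<lambda>h. norm v *\<^sub>R h + (h \<bullet> sgn v) *\<^sub>R v)"
    by (auto simp: radial_matrix_mult sgn_div_norm inner_commute divide_inverse)
  ultimately show ?thesis by simp
qed

text \<open>By orthogonal invariance \<open>v\<close> may be taken to be a multiple of a coordinate vector.\<close>
lemma det_radial_matrix: "det (radial_matrix (v :: real^'n::finite)) = 2 * norm v ^ CARD('n)"
proof -
  \<comment> \<open>Names an arbitrary index for the coordinate axis.\<close>
  obtain k :: 'n where True by simp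
  have "norm v = norm (norm v *\<^sub>R axis k 1 :: real^'n)" by simp
  then obtain f :: "real^'n \<Rightarrow> real^'n" where f: "orthogonal_transformation f" "f v = norm v *\<^sub>R axis k 1"
    using orthogonal_transformation_exists by blast
  define Q where "Q = matrix f"
  have lf: "linear f" and Q: "orthogonal_matrix Q"
    using f(1) unfolding orthogonal_transformation_matrix Q_def by auto
  have Qv: "Q *v v = norm v *\<^sub>R axis k 1"
    unfolding Q_def using f(2) fun_cong[OF matrix_vector_mul(2)[OF lf], of v] by simp
  have QQ: "Q ** transpose Q = mat 1" using Q unfolding orthogonal_matrix_def by simp
  \<comment> \<open>The matrix is built from norms and inner products only, so conjugating it by an
    orthogonal \<open>Q\<close> amounts to rotating \<open>v\<close>.\<close>
  have "Q ** radial_matrix v ** transpose Q = radial_matrix (Q *v v)"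
  proof (subst matrix_eq, rule allI)
    fix w
    have 1: "Q *v (transpose Q *v w) = w"
      by (simp only: matrix_vector_mul_assoc QQ matrix_vector_mul_lid)
    have 2: "v \<bullet> (transpose Q *v w) = (Q *v v) \<bullet> w"
      by (metis dot_lmul_matrix inner_commute transpose_matrix_vector)
    have "(Q ** radial_matrix v ** transpose Q) *v w = Q *v (radial_matrix v *v (transpose Q *v w))"
      by (simp only: matrix_vector_mul_assoc matrix_mul_assoc)
    also have "\<dots> = norm v *\<^sub>R w + ((Q *v v) \<bullet> w / norm v) *\<^sub>R (Q *v v)"
      by (simp add: radial_matrix_mult matrix_vector_right_distrib matrix_vector_mult_scaleR 1 2 del: transpose_matrix_vector)
    also have "norm v = norm (Q *v v)" by (simp add: Qv)
    finally show "(Q ** radial_matrix v ** transpose Q) *v w = radial_matrix (Q *v v) *v w"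
      by (simp add: radial_matrix_mult)
  qed
  then have "det (radial_matrix (Q *v v)) = det Q * det (radial_matrix v) * det (transpose Q)"
    by (simp only: det_mul flip: \<open>Q ** radial_matrix v ** transpose Q = radial_matrix (Q *v v)\<close>)
  also have "\<dots> = det (radial_matrix v)"
    using det_orthogonal_matrix[OF Q] by (auto simp: det_transpose)
  finally have "det (radial_matrix v) = det (radial_matrix (norm v *\<^sub>R axis k 1))" by (simp add: Qv)
  also have "\<dots> = (\<Prod>i\<in>UNIV. radial_matrix (norm v *\<^sub>R axis k 1 :: real^'n) $ i $ i)"
    by (rule det_diagonal) (auto simp: radial_matrix_def axis_def)
  also have "\<dots> = (\<Prod>i\<in>(UNIV::'n set). norm v * (if i = k then 2 else 1))"
    by (rule prod.cong) (auto simp: radial_matrix_def axis_def norm_axis_1[unfolded axis_def])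
  also have "\<dots> = 2 * norm v ^ CARD('n)"
    by (simp add: prod.distrib)
  finally show ?thesis .
qed

lemma norm_radial_matrix_mult_le: "norm (radial_matrix v *v w) \<le> 2 * norm v * norm w"
proof -
  have "norm (radial_matrix v *v w) \<le> norm v * norm w + norm ((v \<bullet> w / norm v) *\<^sub>R v)"
    unfolding radial_matrix_mult by (rule order_trans[OF norm_triangle_ineq]) simp
  also have "norm ((v \<bullet> w / norm v) *\<^sub>R v) \<le> norm v * norm w"
    using Cauchy_Schwarz_ineq2[of v w] by (cases "v = 0") auto
  finally show ?thesis by simp
qed

text \<open>Entries may themselves be vectors, so two applications treat a matrix entry by
  entry.\<close>

lemma borel_measurable_vecI:
  fixes f :: "'a \<Rightarrow> 'b::euclidean_space^'n::finite"
  assumes "\<And>i. (\<lambda>x. f x $ i) \<in> borel_measurable M"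
  shows "f \<in> borel_measurable M"
proof (subst borel_measurable_euclidean_space, rule ballI)
  fix b :: "'b^'n" assume "b \<in> Basis"
  then obtain i c where "b = axis i c" by (auto simp: Basis_vec_def)
  then show "(\<lambda>x. f x \<bullet> b) \<in> borel_measurable M"
    using assms[of i] by (simp add: inner_axis)
qed

lemma borel_measurable_radial_matrix [measurable]: "radial_matrix \<in> borel_measurable borel"
  by (intro borel_measurable_vecI) (simp add: radial_matrix_def)

section \<open>Weak derivatives of Lipschitz maps\<close>

lemma integral_lborel_translate:
  fixes f :: "'a::euclidean_space \<Rightarrow> real"
  assumes [measurable]: "f \<in> borel_measurable borel"
  shows "(\<integral>x. f (c + x) \<partial>lborel) = (\<integral>x. f x \<partial>lborel)"
proof -
  have "(\<integral>x. f x \<partial>lborel) = (\<integral>x. f x \<partial>distr lborel borel ((+) c))"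
    by (simp add: lborel_distr_plus)
  also have "\<dots> = (\<integral>x. f (c + x) \<partial>lborel)" by (rule integral_distr) auto
  finally show ?thesis by simp
qed

lemma integrable_continuous_compact_support:
  fixes f :: "'a::euclidean_space \<Rightarrow> real"
  assumes "continuous_on UNIV f" "compact S" "\<And>x. x \<notin> S \<Longrightarrow> f x = 0"
  shows "integrable lborel f"
proof -
  have "integrable lborel (\<lambda>x. indicator S x *\<^sub>R f x)"
    using assms by (intro borel_integrable_compact) (auto intro: continuous_on_subset)
  also have "(\<lambda>x. indicator S x *\<^sub>R f x) = f" using assms(3) by (intro ext) (auto simp: indicator_def)
  finally show ?thesis .
qed

text \<open>Dominated convergence works along sequences; this one replaces the limit of difference
  quotients at 0.\<close>

lemma inverse_Suc_filterlim: "filterlim (\<lambda>k. inverse (real (Suc k))) (at 0) sequentially"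
  unfolding filterlim_at by (intro conjI LIMSEQ_inverse_real_of_nat) (auto intro!: always_eventually)

lemma derivative_line_quotient:
  assumes "(f has_derivative f') (at x)"
  shows "((\<lambda>h. (f (x + h *\<^sub>R e) - f x) /\<^sub>R h) \<longlongrightarrow> f' e) (at (0::real))"
proof -
  have "((\<lambda>h. x + h *\<^sub>R e) has_derivative (\<lambda>h. h *\<^sub>R e)) (at (0::real))"
    by (auto intro!: derivative_eq_intros)
  then have "((\<lambda>h. f (x + h *\<^sub>R e)) has_derivative (\<lambda>h. f' (h *\<^sub>R e))) (at (0::real))"
    by (rule has_derivative_compose) (use assms in simp)
  then have "((\<lambda>h. norm (f (x + h *\<^sub>R e) - f x - f' (h *\<^sub>R e)) / norm h) \<longlongrightarrow> 0) (at (0::real))"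
    unfolding has_derivative_at by simp
  moreover have "norm (f (x + h *\<^sub>R e) - f x - f' (h *\<^sub>R e)) / norm h
    = norm ((f (x + h *\<^sub>R e) - f x) /\<^sub>R h - f' e)" if "h \<noteq> 0" for h
  proof -
    have "f (x + h *\<^sub>R e) - f x - f' (h *\<^sub>R e) = h *\<^sub>R ((f (x + h *\<^sub>R e) - f x) /\<^sub>R h - f' e)"
      using that linear_scale[OF has_derivative_linear[OF assms], of h e]
      by (simp add: scaleR_diff_right)
    then show ?thesis using that by (simp del: scaleR_diff_right)
  qed
  then have "\<forall>\<^sub>F h in at 0. norm (f (x + h *\<^sub>R e) - f x - f' (h *\<^sub>R e)) / norm h
    = norm ((f (x + h *\<^sub>R e) - f x) /\<^sub>R h - f' e)"
    by (simp add: eventually_at_filter)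
  ultimately have "((\<lambda>h. norm ((f (x + h *\<^sub>R e) - f x) /\<^sub>R h - f' e)) \<longlongrightarrow> 0) (at 0)"
    by (rule Lim_transform_eventually)
  then show ?thesis by (simp only: tendsto_norm_zero_iff LIM_zero_iff)
qed

text \<open>By translation invariance, the forward difference quotient of \<open>g\<close>
  integrated against \<open>\<phi>\<close> equals \<open>g\<close> integrated against the backward
  quotient of \<open>\<phi>\<close>. Both sides have dominated limits: the first because
  \<open>g\<close> is Lipschitz, the second by the mean value theorem.\<close>

lemma integration_by_parts_lipschitz:
  fixes g D \<phi> :: "'a::euclidean_space \<Rightarrow> real"
  assumes g: "L-lipschitz_on UNIV g"
    and D [measurable]: "D \<in> borel_measurable lebesgue"
    and gD: "AE x in lebesgue. ((\<lambda>h. (g (x + h *\<^sub>R e) - g x) /\<^sub>R h) \<longlongrightarrow> D x) (at (0::real))"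
    and \<phi>: "\<And>x. (\<phi> has_derivative \<phi>' x) (at x)" "continuous_on UNIV (\<lambda>x. \<phi>' x e)"
    and S: "compact S" "\<And>x. x \<notin> S \<Longrightarrow> \<phi> x = 0"
  shows "(LINT x|lebesgue. g x * \<phi>' x e) = - (LINT x|lebesgue. D x * \<phi> x)"
proof -
  define h where "h k = inverse (real (Suc k))" for k
  have h: "0 < h k" "h k \<le> 1" for k by (auto simp: h_def divide_simps)
  have hlim: "filterlim h (at 0) sequentially"
    unfolding h_def[abs_def] by (rule inverse_Suc_filterlim)
  \<comment> \<open>\<open>K\<close> contains the supports of all translates of
    \<open>\<phi>\<close> by \<open>t\<close> times \<open>e\<close>,
    \<open>0 \<le> t \<le> 1\<close>; \<open>K2\<close> enlarges it once more to contain the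
    intermediate points of the mean value theorem.\<close>
  define K where "K = {x + y |x y. x \<in> S \<and> y \<in> cball 0 (norm e)}"
  define K2 where "K2 = {x + y |x y. x \<in> K \<and> y \<in> cball 0 (norm e)}"
  have K: "compact K" "compact K2" unfolding K_def K2_def by (intro compact_sums S compact_cball)+
  have shift: "x \<in> K" if "x - t *\<^sub>R e \<in> S" "0 \<le> t" "t \<le> 1" for x t
  proof -
    have "norm (t *\<^sub>R e) \<le> norm e" using that mult_right_mono[of t 1 "norm e"] by simp
    then show ?thesis unfolding K_def using that(1)
      by (intro CollectI exI[of _ "x - t *\<^sub>R e"] exI[of _ "t *\<^sub>R e"]) simp
  qed
  have shift2: "x - t *\<^sub>R e \<in> K2" if "x \<in> K" "0 \<le> t" "t \<le> 1" for x t
  proof -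
    have "norm (t *\<^sub>R e) \<le> norm e" using that mult_right_mono[of t 1 "norm e"] by simp
    then show ?thesis unfolding K2_def using that(1)
      by (intro CollectI exI[of _ x] exI[of _ "- (t *\<^sub>R e)"]) simp
  qed
  have cont\<phi>: "continuous_on UNIV \<phi>"
    using \<phi>(1) by (meson continuous_at_imp_continuous_on has_derivative_continuous)
  have contg: "continuous_on UNIV g" using g by (rule lipschitz_on_continuous_on)
  note [measurable] = borel_measurable_continuous_onI[OF cont\<phi>] borel_measurable_continuous_onI[OF contg]
    borel_measurable_continuous_onI[OF \<phi>(2)]
  have contg2: "continuous_on UNIV (\<lambda>x. g (x + a))" for a
    by (rule continuous_on_compose2[OF contg]) (auto intro!: continuous_intros)
  have cont\<phi>2: "continuous_on UNIV (\<lambda>x. \<phi> (x - a))" for a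
    by (rule continuous_on_compose2[OF cont\<phi>]) (auto intro!: continuous_intros)
  obtain B where B: "\<And>x. x \<in> K2 \<Longrightarrow> norm (\<phi>' x e) \<le> B"
    using compact_imp_bounded[OF compact_continuous_image[OF continuous_on_subset[OF \<phi>(2) subset_UNIV] K(2)]]
    unfolding bounded_iff by auto
  define s where "s k x = (g (x + h k *\<^sub>R e) - g x) / h k * \<phi> x" for k x
  define q where "q k x = g x * ((\<phi> (x - h k *\<^sub>R e) - \<phi> x) / h k)" for k x
  have eq: "(\<integral>x. s k x \<partial>lborel) = (\<integral>x. q k x \<partial>lborel)" for k
  proof -
    have i1: "integrable lborel (\<lambda>x. g (x + h k *\<^sub>R e) * \<phi> x)"
      by (rule integrable_continuous_compact_support[OF _ S(1)])
        (auto intro!: continuous_intros contg2 cont\<phi> simp: S(2))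
    have i2: "integrable lborel (\<lambda>x. g x * \<phi> x)"
      by (rule integrable_continuous_compact_support[OF _ S(1)])
        (auto intro!: continuous_intros contg cont\<phi> simp: S(2))
    have i3: "integrable lborel (\<lambda>x. g x * \<phi> (x - h k *\<^sub>R e))"
    proof (rule integrable_continuous_compact_support[OF _ K(1)])
      show "g x * \<phi> (x - h k *\<^sub>R e) = 0" if "x \<notin> K" for x
        using that shift[of x "h k"] h[of k] S(2) by force
    qed (intro continuous_intros contg cont\<phi>2)
    have "(\<integral>x. g x * \<phi> (x - h k *\<^sub>R e) \<partial>lborel) = (\<integral>x. g (h k *\<^sub>R e + x) * \<phi> x \<partial>lborel)"
      using integral_lborel_translate[of "\<lambda>x. g x * \<phi> (x - h k *\<^sub>R e)" "h k *\<^sub>R e"] by simp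
    then have tr: "(\<integral>x. g (x + h k *\<^sub>R e) * \<phi> x \<partial>lborel) = (\<integral>x. g x * \<phi> (x - h k *\<^sub>R e) \<partial>lborel)"
      by (simp add: add.commute)
    have "(\<integral>x. s k x \<partial>lborel) = (\<integral>x. (g (x + h k *\<^sub>R e) * \<phi> x - g x * \<phi> x) / h k \<partial>lborel)"
      unfolding s_def by (intro Bochner_Integration.integral_cong) (auto simp: field_simps)
    also have "\<dots> = ((\<integral>x. g (x + h k *\<^sub>R e) * \<phi> x \<partial>lborel) - (\<integral>x. g x * \<phi> x \<partial>lborel)) / h k"
      using i1 i2 by simp
    also have "\<dots> = ((\<integral>x. g x * \<phi> (x - h k *\<^sub>R e) \<partial>lborel) - (\<integral>x. g x * \<phi> x \<partial>lborel)) / h k"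
      by (simp add: tr)
    also have "\<dots> = (\<integral>x. (g x * \<phi> (x - h k *\<^sub>R e) - g x * \<phi> x) / h k \<partial>lborel)"
      using i3 i2 by simp
    also have "\<dots> = (\<integral>x. q k x \<partial>lborel)"
      unfolding q_def by (intro Bochner_Integration.integral_cong) (auto simp: field_simps)
    finally show ?thesis .
  qed
  have s_meas [measurable]: "s k \<in> borel_measurable borel" for k unfolding s_def by measurable
  have q_meas [measurable]: "q k \<in> borel_measurable borel" for k unfolding q_def by measurable
  have [measurable]: "\<phi> \<in> borel_measurable lebesgue"
    by (rule measurable_completion) simp
  have slim: "(\<lambda>k. LINT x|lebesgue. s k x) \<longlonglongrightarrow> (LINT x|lebesgue. D x * \<phi> x)"
  proof (rule integral_dominated_convergence[where w = "\<lambda>x. L * norm e * \<bar>\<phi> x\<bar>"])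
    show "s k \<in> borel_measurable lebesgue" for k by (rule measurable_completion) simp
    have "integrable lborel (\<lambda>x. L * norm e * \<bar>\<phi> x\<bar>)"
      by (rule integrable_continuous_compact_support[OF _ S(1)])
        (auto intro!: continuous_intros cont\<phi> simp: S(2))
    then show "integrable lebesgue (\<lambda>x. L * norm e * \<bar>\<phi> x\<bar>)"
      by (subst integrable_completion) auto
    show "AE x in lebesgue. norm (s k x) \<le> L * norm e * \<bar>\<phi> x\<bar>" for k
    proof (rule AE_I2)
      fix x
      have "\<bar>g (x + h k *\<^sub>R e) - g x\<bar> \<le> L * (h k * norm e)"
        using lipschitz_onD[OF g, of "x + h k *\<^sub>R e" x] h[of k] by (simp add: dist_norm)
      then have "\<bar>g (x + h k *\<^sub>R e) - g x\<bar> / h k \<le> L * norm e"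
        using h[of k] by (simp add: field_simps)
      then have "\<bar>g (x + h k *\<^sub>R e) - g x\<bar> / h k * \<bar>\<phi> x\<bar> \<le> L * norm e * \<bar>\<phi> x\<bar>"
        by (rule mult_right_mono) simp
      then show "norm (s k x) \<le> L * norm e * \<bar>\<phi> x\<bar>"
        unfolding s_def using h[of k] by (simp add: abs_mult)
    qed
    show "AE x in lebesgue. (\<lambda>k. s k x) \<longlonglongrightarrow> D x * \<phi> x"
      using gD
    proof eventually_elim
      case (elim x)
      from filterlim_compose[OF this hlim]
      have "(\<lambda>k. (g (x + h k *\<^sub>R e) - g x) / h k) \<longlonglongrightarrow> D x"
        by (simp add: divide_inverse mult.commute)
      then show ?case unfolding s_def by (intro tendsto_intros)
    qed
  qed measurable
  have qlim: "(\<lambda>k. LINT x|lborel. q k x) \<longlonglongrightarrow> (LINT x|lborel. - (g x * \<phi>' x e))"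
  proof (rule integral_dominated_convergence[where w = "\<lambda>x. indicator K x *\<^sub>R (\<bar>g x\<bar> * B)"])
    show "integrable lborel (\<lambda>x. indicator K x *\<^sub>R (\<bar>g x\<bar> * B))"
      by (rule borel_integrable_compact[OF K(1)])
        (auto intro!: continuous_intros continuous_on_subset[OF contg])
    show "AE x in lborel. norm (q k x) \<le> indicator K x *\<^sub>R (\<bar>g x\<bar> * B)" for k
    proof (rule AE_I2)
      fix x
      show "norm (q k x) \<le> indicator K x *\<^sub>R (\<bar>g x\<bar> * B)"
      proof (cases "x \<in> K")
        case False
        then have "\<phi> x = 0" "\<phi> (x - h k *\<^sub>R e) = 0"
          using shift[of x 0] shift[of x "h k"] h[of k] S(2) by force+
        then show ?thesis by (simp add: q_def False)
      next
        case True
        have der: "((\<lambda>t. \<phi> (x - t *\<^sub>R e)) has_derivative (\<lambda>u. \<phi>' (x - t *\<^sub>R e) (- (u *\<^sub>R e)))) (at t within {0..h k})" for t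
          by (rule has_derivative_compose[OF _ \<phi>(1)]) (auto intro!: derivative_eq_intros)
        obtain t where t: "t \<in> {0<..<h k}"
          "\<phi> (x - h k *\<^sub>R e) - \<phi> (x - 0 *\<^sub>R e) = \<phi>' (x - t *\<^sub>R e) (- ((h k - 0) *\<^sub>R e))"
          using mvt_simple[OF h(1)[of k] der] by blast
        have "\<phi>' (x - t *\<^sub>R e) (- ((h k - 0) *\<^sub>R e)) = - h k * \<phi>' (x - t *\<^sub>R e) e"
          using linear_scale[OF has_derivative_linear[OF \<phi>(1)], of "x - t *\<^sub>R e" "- h k" e] by simp
        then have "(\<phi> (x - h k *\<^sub>R e) - \<phi> x) / h k = - \<phi>' (x - t *\<^sub>R e) e"
          using t h[of k] by (simp add: field_simps)
        moreover have "norm (\<phi>' (x - t *\<^sub>R e) e) \<le> B"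
          using B shift2[OF True, of t] t h[of k] by force
        ultimately show ?thesis
          unfolding q_def using True by (simp add: abs_mult mult_left_mono)
      qed
    qed
    show "AE x in lborel. (\<lambda>k. q k x) \<longlonglongrightarrow> - (g x * \<phi>' x e)"
    proof (rule AE_I2)
      fix x
      \<comment> \<open>The shift acts on \<open>\<phi>\<close> in the direction \<open>- e\<close>;
        this produces the minus sign of the formula.\<close>
      from filterlim_compose[OF derivative_line_quotient[OF \<phi>(1)] hlim, of x "- e"]
      have "(\<lambda>k. (\<phi> (x - h k *\<^sub>R e) - \<phi> x) / h k) \<longlonglongrightarrow> \<phi>' x (- e)"
        by (simp add: divide_inverse mult.commute)
      moreover have "\<phi>' x (- e) = - \<phi>' x e"
        using linear_neg[OF has_derivative_linear[OF \<phi>(1)]] .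
      ultimately show "(\<lambda>k. q k x) \<longlonglongrightarrow> - (g x * \<phi>' x e)"
        unfolding q_def by (metis mult_minus_right tendsto_mult_left)
    qed
  qed measurable
  have "(LINT x|lebesgue. s k x) = (LINT x|lborel. q k x)" for k
    using eq[of k] by (simp add: integral_completion)
  then have "(LINT x|lebesgue. D x * \<phi> x) = (LINT x|lborel. - (g x * \<phi>' x e))"
    using slim qlim LIMSEQ_unique by simp
  also have "\<dots> = - (LINT x|lebesgue. g x * \<phi>' x e)"
    by (simp add: integral_completion)
  finally show ?thesis by simp
qed

lemma norm_matrix_le:
  fixes A :: "real^'n::finite^'m::finite"
  assumes "\<And>i j. \<bar>A $ i $ j\<bar> \<le> B"
  shows "norm A \<le> real CARD('m) * (real CARD('n) * B)"
proof -
  have r: "norm (A $ i) \<le> real CARD('n) * B" for i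
    using norm_le_l1_cart[of "A $ i"] sum_bounded_above[of UNIV "\<lambda>j. \<bar>A $ i $ j\<bar>" B] assms by simp
  have "norm A \<le> (\<Sum>i\<in>UNIV. norm (A $ i))"
    unfolding norm_vec_def by (rule L2_set_le_sum) simp
  also have "\<dots> \<le> real CARD('m) * (real CARD('n) * B)"
    using sum_bounded_above[of UNIV "\<lambda>i. norm (A $ i)", OF r] by simp
  finally show ?thesis .
qed

text \<open>The entries of \<open>Df\<close> are almost everywhere limits of difference quotients,
  hence bounded by \<open>L\<close>; this makes \<open>Df\<close> locally integrable. The weak
  derivative identity is then integration by parts for each component and coordinate
  direction.\<close>

lemma W11_loc_derivative_lipschitz:
  fixes f :: "real^'n::finite \<Rightarrow> real^'n"
  assumes f: "L-lipschitz_on UNIV f"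
    and Df [measurable]: "Df \<in> borel_measurable lebesgue"
    and ae: "AE x in lebesgue. (f has_derivative (*v) (Df x)) (at x)"
  shows "W11_loc_derivative f Df"
proof -
  have comp_lip: "L-lipschitz_on UNIV (\<lambda>x. f x $ i)" for i
    by (rule lipschitz_onI)
      (use lipschitz_onD[OF f] lipschitz_on_nonneg[OF f] in \<open>auto intro: order_trans[OF dist_vec_nth_le]\<close>)
  have quot: "((\<lambda>h. (f (x + h *\<^sub>R axis j 1) $ i - f x $ i) /\<^sub>R h) \<longlongrightarrow> Df x $ i $ j) (at (0::real))"
    if "(f has_derivative (*v) (Df x)) (at x)" for x i j
    using tendsto_vec_nth[OF derivative_line_quotient[OF that, of "axis j 1"], of i]
    by (simp add: matrix_vector_mul_component inner_axis)
  have bound: "norm (Df x) \<le> real CARD('n) * (real CARD('n) * L)"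
    if "(f has_derivative (*v) (Df x)) (at x)" for x
  proof (rule norm_matrix_le)
    fix i j
    have "norm (Df x $ i $ j) \<le> L"
    proof (rule tendsto_upperbound[OF tendsto_norm[OF quot[OF that]]])
      show "\<forall>\<^sub>F h in at (0::real). norm ((f (x + h *\<^sub>R axis j 1) $ i - f x $ i) /\<^sub>R h) \<le> L"
        unfolding eventually_at_filter
      proof (intro always_eventually allI impI)
        fix h :: real assume "h \<noteq> 0"
        then show "norm ((f (x + h *\<^sub>R axis j 1) $ i - f x $ i) /\<^sub>R h) \<le> L"
          using lipschitz_onD[OF comp_lip, of "x + h *\<^sub>R axis j 1" x i]
          by (simp add: dist_norm norm_axis_1 field_simps)
      qed
    qed simp
    then show "\<bar>Df x $ i $ j\<bar> \<le> L" by simp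
  qed
  have contf: "continuous_on UNIV f" using f by (rule lipschitz_on_continuous_on)
  have "locally_integrable f"
    unfolding locally_integrable_def set_integrable_def
  proof (intro allI impI)
    fix K :: "(real^'n) set" assume K: "compact K"
    have "integrable lborel (\<lambda>x. indicator K x *\<^sub>R f x)"
      by (rule borel_integrable_compact[OF K]) (rule continuous_on_subset[OF contf subset_UNIV])
    then show "integrable lebesgue (\<lambda>x. indicator K x *\<^sub>R f x)"
      by (subst integrable_completion) auto
  qed
  moreover have "locally_integrable Df"
    unfolding locally_integrable_def set_integrable_def
  proof (intro allI impI)
    fix K :: "(real^'n) set" assume K: "compact K"
    then have Ks: "K \<in> sets lebesgue" using lmeasurable_compact by (blast dest: fmeasurableD)
    show "integrable lebesgue (\<lambda>x. indicator K x *\<^sub>R Df x)"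
    proof (rule integrableI_bounded_set_indicator[OF Ks Df])
      show "emeasure lebesgue K < \<infinity>"
        unfolding infinity_ennreal_def less_top[symmetric]
        by (rule fmeasurableD2[OF lmeasurable_compact[OF K]])
      show "AE x\<in>K in lebesgue. norm (Df x) \<le> real CARD('n) * (real CARD('n) * L)"
        using ae by eventually_elim (auto intro: bound)
    qed
  qed
  moreover have "(LINT x|lebesgue. f x $ i * frechet_derivative \<phi> (at x) (axis j 1)) =
        - (LINT x|lebesgue. Df x $ i $ j * \<phi> x)" if \<phi>: "test_function \<phi>" for \<phi> i j
  proof -
    have C1: "Ck (Suc 0) \<phi>" and supp: "compact (closure {x. \<phi> x \<noteq> 0})"
      using \<phi> unfolding test_function_def by blast+
    have 1: "(\<phi> has_derivative frechet_derivative \<phi> (at x)) (at x)" for x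
      using C1 by (simp add: frechet_derivative_works[symmetric])
    have 2: "continuous_on UNIV (\<lambda>x. frechet_derivative \<phi> (at x) (axis j 1))"
      using C1 by simp
    have 3: "\<phi> x = 0" if "x \<notin> closure {x. \<phi> x \<noteq> 0}" for x
      using that subsetD[OF closure_subset, of x "{x. \<phi> x \<noteq> 0}"] by auto
    have 4: "AE x in lebesgue. ((\<lambda>h. (f (x + h *\<^sub>R axis j 1) $ i - f x $ i) /\<^sub>R h) \<longlongrightarrow> Df x $ i $ j) (at (0::real))"
      using ae by eventually_elim (rule quot)
    have 5: "(\<lambda>x. Df x $ i $ j) \<in> borel_measurable lebesgue"
      by (rule measurable_compose[OF Df borel_measurable_continuous_onI]) (intro continuous_intros)
    show ?thesis
      by (rule integration_by_parts_lipschitz[OF comp_lip 5 4 1 2 supp 3])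
  qed
  ultimately show ?thesis unfolding W11_loc_derivative_def by blast
qed

section \<open>Stretching a disjoint family of balls\<close>

text \<open>The radial stretching of one ball, continued by the identity. If \<open>w\<close> is the
  shorter vector, the difference splits as in the product rule and each part costs one
  \<open>norm (v - w)\<close>: the scaling factor is at most 1, and where the factors differ
  \<open>norm w < \<rho>\<close> cancels the Lipschitz constant \<open>1 / \<rho>\<close> of the
  factor.\<close>

lemma min_norm_scaleR_lipschitz:
  fixes v w :: "'a::real_normed_vector"
  assumes "0 < \<rho>"
  shows "norm (min 1 (norm v / \<rho>) *\<^sub>R v - min 1 (norm w / \<rho>) *\<^sub>R w) \<le> 2 * norm (v - w)"
proof -
  have main: "norm (min 1 (norm v / \<rho>) *\<^sub>R v - min 1 (norm w / \<rho>) *\<^sub>R w) \<le> 2 * norm (v - w)"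
    if "norm w \<le> norm v" for v w :: 'a
  proof -
    let ?m = "min 1 (norm v / \<rho>)" and ?k = "min 1 (norm w / \<rho>)"
    have mk: "0 \<le> ?m" "?m \<le> 1" "?k \<le> ?m"
      using assms that divide_right_mono[OF that, of \<rho>] by (auto simp: min_def)
    have "?m *\<^sub>R v - ?k *\<^sub>R w = ?m *\<^sub>R (v - w) + (?m - ?k) *\<^sub>R w"
      by (simp add: algebra_simps)
    then have "norm (?m *\<^sub>R v - ?k *\<^sub>R w) \<le> norm (?m *\<^sub>R (v - w)) + norm ((?m - ?k) *\<^sub>R w)"
      by (metis norm_triangle_ineq)
    also have "norm (?m *\<^sub>R (v - w)) \<le> norm (v - w)"
      using mult_right_mono[OF mk(2) norm_ge_zero[of "v - w"]] mk(1) by simp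
    also have "norm ((?m - ?k) *\<^sub>R w) \<le> norm (v - w)"
    proof (cases "norm w < \<rho>")
      case False
      then have "?m = 1" "?k = 1" using that assms by (auto simp: min_def divide_simps)
      then show ?thesis by simp
    next
      case True
      then have k: "?k = norm w / \<rho>" using assms by (simp add: min_def divide_simps)
      have "?m - ?k \<le> (norm v - norm w) / \<rho>" unfolding k by (simp add: diff_divide_distrib)
      also have "\<dots> \<le> norm (v - w) / \<rho>"
        using assms by (intro divide_right_mono norm_triangle_ineq2) simp
      finally have "(?m - ?k) * norm w \<le> norm (v - w) / \<rho> * norm w"
        by (rule mult_right_mono) simp
      also have "\<dots> \<le> norm (v - w) / \<rho> * \<rho>"
        using True assms by (intro mult_left_mono) auto
      finally have "(?m - ?k) * norm w \<le> norm (v - w)" using assms by simp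
      then show ?thesis using mk by simp
    qed
    finally show ?thesis by simp
  qed
  show ?thesis
  proof (cases "norm w \<le> norm v")
    case True then show ?thesis by (rule main)
  next
    case False
    then show ?thesis using main[of v w] by (simp add: norm_minus_commute)
  qed
qed

lemma inj_norm_scaleR:
  fixes v w :: "'a::real_normed_vector"
  assumes "norm v *\<^sub>R v = norm w *\<^sub>R w"
  shows "v = w"
proof -
  have "norm v * norm v = norm w * norm w"
    using arg_cong[OF assms, of norm] by simp
  then have "norm v = norm w" by (metis abs_norm_cancel real_sqrt_abs2)
  then show ?thesis using assms by (cases "norm v = 0") auto
qed

lemma det_scaleR: "det (a *\<^sub>R (A :: real^'n::finite^'n)) = a ^ CARD('n) * det A"
proof -
  have "a *\<^sub>R A = (\<chi> i. a *s A $ i)" by (simp add: vec_eq_iff)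
  then show ?thesis using det_rows_mul[of "\<lambda>_. a" "\<lambda>i. A $ i"] by simp
qed

text \<open>The index type is countable so that the bounding spheres together form a null set and
  the derivative is glued from countably many measurable pieces.\<close>

locale ball_family =
  fixes c :: "'i::countable \<Rightarrow> real^'n::finite" and \<rho> :: "'i \<Rightarrow> real"
  assumes \<rho>_pos: "0 < \<rho> i"
    and disjoint: "i \<noteq> j \<Longrightarrow> ball (c i) (\<rho> i) \<inter> ball (c j) (\<rho> j) = {}"
begin

definition stretch :: "real^'n \<Rightarrow> real^'n" where
  "stretch x = (if \<exists>i. x \<in> ball (c i) (\<rho> i)
    then (let i = THE i. x \<in> ball (c i) (\<rho> i) in c i + (norm (x - c i) / \<rho> i) *\<^sub>R (x - c i))
    else x)"

text \<open>On the bounding spheres the value \<open>mat 1\<close> is an arbitrary choice. At a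
  center, division by zero yields the zero matrix.\<close>

definition stretch_deriv :: "real^'n \<Rightarrow> real^'n^'n" where
  "stretch_deriv x = (if \<exists>i. x \<in> ball (c i) (\<rho> i)
    then (let i = THE i. x \<in> ball (c i) (\<rho> i) in (1 / \<rho> i) *\<^sub>R radial_matrix (x - c i))
    else mat 1)"

lemma the_ball: "x \<in> ball (c i) (\<rho> i) \<Longrightarrow> (THE i. x \<in> ball (c i) (\<rho> i)) = i"
  by (rule the_equality) (use disjoint in \<open>blast+\<close>)

lemma stretch_in: "x \<in> ball (c i) (\<rho> i) \<Longrightarrow> stretch x = c i + (norm (x - c i) / \<rho> i) *\<^sub>R (x - c i)"
  unfolding stretch_def Let_def by (subst if_P, blast, simp only: the_ball)

lemma stretch_deriv_in:
  "x \<in> ball (c i) (\<rho> i) \<Longrightarrow> stretch_deriv x = (1 / \<rho> i) *\<^sub>R radial_matrix (x - c i)"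
  unfolding stretch_deriv_def Let_def by (subst if_P, blast, simp only: the_ball)

lemma stretch_out: "(\<And>i. x \<notin> ball (c i) (\<rho> i)) \<Longrightarrow> stretch x = x"
  unfolding stretch_def by (simp del: mem_ball)

lemma stretch_deriv_out: "(\<And>i. x \<notin> ball (c i) (\<rho> i)) \<Longrightarrow> stretch_deriv x = mat 1"
  unfolding stretch_deriv_def by (simp del: mem_ball)

lemma in_ball_norm: "x \<in> ball (c i) (\<rho> i) \<longleftrightarrow> norm (x - c i) < \<rho> i"
  by (simp add: dist_norm norm_minus_commute)

lemma stretch_mem:
  assumes "x \<in> ball (c i) (\<rho> i)"
  shows "stretch x \<in> ball (c i) (\<rho> i)"
proof -
  have v: "norm (x - c i) < \<rho> i" using assms in_ball_norm by blast
  have "norm (x - c i) * norm (x - c i) < \<rho> i * \<rho> i"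
    using v by (intro mult_strict_mono) (auto simp: \<rho>_pos)
  then have "norm (x - c i) / \<rho> i * norm (x - c i) < \<rho> i"
    using \<rho>_pos[of i] by (simp add: divide_simps)
  then show ?thesis
    using \<rho>_pos[of i] unfolding in_ball_norm stretch_in[OF assms] by simp
qed

text \<open>Stretches a single ball and fixes everything else; two points never need more than two
  of these maps.\<close>

definition stretch_at :: "'i \<Rightarrow> real^'n \<Rightarrow> real^'n" where
  "stretch_at i x = c i + min 1 (norm (x - c i) / \<rho> i) *\<^sub>R (x - c i)"

lemma stretch_at_in:
  assumes "x \<in> ball (c i) (\<rho> i)"
  shows "stretch_at i x = stretch x"
proof -
  have "norm (x - c i) / \<rho> i \<le> 1"
    using assms \<rho>_pos[of i] unfolding in_ball_norm by simp
  then show ?thesis by (simp add: stretch_in[OF assms] stretch_at_def min_absorb2)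
qed

lemma stretch_at_out:
  assumes "x \<notin> ball (c i) (\<rho> i)"
  shows "stretch_at i x = x"
proof -
  have "1 \<le> norm (x - c i) / \<rho> i"
    using assms \<rho>_pos[of i] unfolding in_ball_norm by simp
  then show ?thesis by (simp add: stretch_at_def min_absorb1)
qed

lemma stretch_at_lipschitz: "norm (stretch_at i x - stretch_at i y) \<le> 2 * norm (x - y)"
  using min_norm_scaleR_lipschitz[OF \<rho>_pos[of i], of "x - c i" "y - c i"]
  unfolding stretch_at_def by simp

text \<open>The constant comes from points in two different balls \<open>i\<close> and
  \<open>j\<close>. There \<open>stretch_at i\<close> fixes \<open>y\<close> and
  \<open>stretch_at j\<close> fixes \<open>x\<close>, so the difference telescopes into three terms
  with constants 2, 1 and 2. All other cases need only one map \<open>stretch_at\<close>.\<close>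

lemma stretch_lipschitz: "5-lipschitz_on UNIV stretch"
proof (rule lipschitz_onI)
  fix x y :: "real^'n"
  have five: "2 * norm (x - y) \<le> 5 * norm (x - y)" by (intro mult_right_mono) auto
  show "dist (stretch x) (stretch y) \<le> 5 * dist x y"
    unfolding dist_norm
  proof (cases "\<exists>i. x \<in> ball (c i) (\<rho> i)")
    case nx: False
    show "norm (stretch x - stretch y) \<le> 5 * norm (x - y)"
    proof (cases "\<exists>j. y \<in> ball (c j) (\<rho> j)")
      case False
      then have "stretch x = x" "stretch y = y" using nx stretch_out by blast+
      then show ?thesis using norm_ge_zero[of "x - y"] by (simp del: norm_ge_zero)
    next
      case True
      then obtain j where j: "y \<in> ball (c j) (\<rho> j)" by blast
      have "stretch x = stretch_at j x" "stretch y = stretch_at j y"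
        using nx stretch_out stretch_at_out stretch_at_in[OF j] by metis+
      then show ?thesis using order_trans[OF stretch_at_lipschitz[of j x y] five] by simp
    qed
  next
    case True
    then obtain i where i: "x \<in> ball (c i) (\<rho> i)" by blast
    show "norm (stretch x - stretch y) \<le> 5 * norm (x - y)"
    proof (cases "\<exists>j. y \<in> ball (c j) (\<rho> j) \<and> j \<noteq> i")
      case False
      then have "stretch y = stretch_at i y"
        using stretch_out stretch_at_out stretch_at_in by metis
      then show ?thesis using order_trans[OF stretch_at_lipschitz[of i x y] five] stretch_at_in[OF i] by simp
    next
      case True
      then obtain j where j: "y \<in> ball (c j) (\<rho> j)" "j \<noteq> i" by blast
      then have nj: "y \<notin> ball (c i) (\<rho> i)" and ni: "x \<notin> ball (c j) (\<rho> j)"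
        using disjoint[of i j] i by blast+
      have "stretch x - stretch y = (stretch_at i x - stretch_at i y) + (y - x)
          + (stretch_at j x - stretch_at j y)"
        using stretch_at_in[OF i] stretch_at_in[OF j(1)] stretch_at_out[OF ni] stretch_at_out[OF nj]
        by simp
      also have "norm \<dots> \<le> 2 * norm (x - y) + norm (x - y) + 2 * norm (x - y)"
        by (intro norm_triangle_mono stretch_at_lipschitz) (simp add: norm_minus_commute)
      finally show ?thesis by simp
    qed
  qed
qed simp

section \<open>Bijectivity of the stretching\<close>

lemma stretch_mem_iff: "stretch x \<in> ball (c i) (\<rho> i) \<longleftrightarrow> x \<in> ball (c i) (\<rho> i)"
proof
  assume a: "stretch x \<in> ball (c i) (\<rho> i)"
  show "x \<in> ball (c i) (\<rho> i)"
  proof (cases "\<exists>j. x \<in> ball (c j) (\<rho> j)")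
    case True
    then obtain j where j: "x \<in> ball (c j) (\<rho> j)" by blast
    then have "i = j" using stretch_mem[OF j] a disjoint[of i j] by blast
    then show ?thesis using j by simp
  next
    case False
    then show ?thesis using a stretch_out by metis
  qed
qed (rule stretch_mem)

lemma inj_stretch: "inj stretch"
proof (rule injI)
  fix x y assume eq: "stretch x = stretch y"
  show "x = y"
  proof (cases "\<exists>i. x \<in> ball (c i) (\<rho> i)")
    case True
    then obtain i where i: "x \<in> ball (c i) (\<rho> i)" by blast
    then have j: "y \<in> ball (c i) (\<rho> i)" using eq stretch_mem_iff by metis
    have "(1 / \<rho> i) *\<^sub>R (norm (x - c i) *\<^sub>R (x - c i)) = (1 / \<rho> i) *\<^sub>R (norm (y - c i) *\<^sub>R (y - c i))"
      using eq unfolding stretch_in[OF i] stretch_in[OF j] by simp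
    then have "norm (x - c i) *\<^sub>R (x - c i) = norm (y - c i) *\<^sub>R (y - c i)"
      using \<rho>_pos[of i] by (simp only: scaleR_cancel_left) simp
    then show ?thesis using inj_norm_scaleR by fastforce
  next
    case False
    then have "\<And>i. y \<notin> ball (c i) (\<rho> i)" using eq stretch_mem_iff by metis
    then show ?thesis using False eq stretch_out by metis
  qed
qed

lemma surj_stretch: "surj stretch"
proof -
  have "\<exists>x. y = stretch x" for y
  proof (cases "\<exists>i. y \<in> ball (c i) (\<rho> i)")
    case False
    then show ?thesis using stretch_out by metis
  next
    case True
    then obtain i where i: "y \<in> ball (c i) (\<rho> i)" by blast
    define w where "w = y - c i"
    have w: "norm w < \<rho> i" using i unfolding in_ball_norm w_def .
    \<comment> \<open>Inverts the radial profile: this point has distance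
      \<open>sqrt (\<rho> i * norm w)\<close> from the center, whose square divided by
      \<open>\<rho> i\<close> is \<open>norm w\<close>.\<close>
    define x where "x = c i + sqrt (\<rho> i / norm w) *\<^sub>R w"
    show ?thesis
    proof (cases "w = 0")
      case True
      then have "stretch y = y" using stretch_in[OF i] by (simp add: w_def)
      then show ?thesis by metis
    next
      case False
      have "norm (x - c i) = sqrt (\<rho> i / norm w) * sqrt (norm w * norm w)"
        using \<rho>_pos[of i] by (simp add: x_def)
      also have "\<dots> = sqrt (\<rho> i * norm w)"
        unfolding real_sqrt_mult[symmetric] using False by simp
      finally have nx: "norm (x - c i) = sqrt (\<rho> i * norm w)" .
      also have "\<dots> < sqrt (\<rho> i * \<rho> i)"
        using w \<rho>_pos[of i] by (intro real_sqrt_less_mono) simp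
      finally have x: "x \<in> ball (c i) (\<rho> i)"
        using \<rho>_pos[of i] unfolding in_ball_norm by simp
      have "norm (x - c i) / \<rho> i * sqrt (\<rho> i / norm w) = sqrt (\<rho> i * norm w * (\<rho> i / norm w)) / \<rho> i"
        unfolding nx real_sqrt_mult by simp
      also have "\<rho> i * norm w * (\<rho> i / norm w) = \<rho> i * \<rho> i" using False by simp
      also have "sqrt (\<rho> i * \<rho> i) / \<rho> i = 1" using \<rho>_pos[of i] by simp
      finally have "(norm (x - c i) / \<rho> i) *\<^sub>R (x - c i) = w"
        by (simp add: x_def)
      then have "stretch x = y" unfolding stretch_in[OF x] by (simp add: w_def)
      then show ?thesis by metis
    qed
  qed
  then show ?thesis by (simp add: surj_def)
qed

text \<open>Continuity of the inverse comes from invariance of domain.\<close>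

lemma homeomorphism_stretch: "\<exists>g. homeomorphism UNIV UNIV stretch g"
proof -
  obtain g where "homeomorphism UNIV (range stretch) stretch g"
    using invariance_of_domain_homeomorphism[OF open_UNIV
      lipschitz_on_continuous_on[OF stretch_lipschitz] order_refl inj_stretch] .
  then show ?thesis using surj_stretch by auto
qed

section \<open>Jacobian and dilatation\<close>

lemma det_stretch_deriv_in:
  assumes "x \<in> ball (c i) (\<rho> i)"
  shows "det (stretch_deriv x) = 2 * (norm (x - c i) / \<rho> i) ^ CARD('n)"
  unfolding stretch_deriv_in[OF assms] det_scaleR det_radial_matrix by (simp add: power_divide)

lemma det_stretch_deriv_out: "(\<And>i. x \<notin> ball (c i) (\<rho> i)) \<Longrightarrow> det (stretch_deriv x) = 1"
  by (subst stretch_deriv_out) simp_all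

lemma det_stretch_deriv_nonneg: "0 \<le> det (stretch_deriv x)"
proof (cases "\<exists>i. x \<in> ball (c i) (\<rho> i)")
  case True
  then obtain i where "x \<in> ball (c i) (\<rho> i)" by blast
  then show ?thesis using \<rho>_pos[of i] by (subst det_stretch_deriv_in) auto
next
  case False
  then have "det (stretch_deriv x) = 1" using det_stretch_deriv_out by blast
  then show ?thesis by simp
qed

lemma det_stretch_deriv_le: "det (stretch_deriv x) \<le> 2"
proof (cases "\<exists>i. x \<in> ball (c i) (\<rho> i)")
  case True
  then obtain i where i: "x \<in> ball (c i) (\<rho> i)" by blast
  have "(norm (x - c i) / \<rho> i) ^ CARD('n) \<le> 1"
    using i \<rho>_pos[of i] unfolding in_ball_norm by (intro power_le_one) auto
  then show ?thesis by (simp add: det_stretch_deriv_in[OF i])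
next
  case False
  then have "det (stretch_deriv x) = 1" using det_stretch_deriv_out by blast
  then show ?thesis by simp
qed

text \<open>Inside a ball the operator norm is at most twice the relative distance to the center,
  and the Jacobian is twice its power of order \<open>CARD('n)\<close>; the constant leaves a factor
  2 to spare.\<close>

lemma onorm_stretch_deriv_le:
  "onorm ((*v) (stretch_deriv x)) ^ CARD('n) \<le> 2 ^ CARD('n) * det (stretch_deriv x)"
proof (cases "\<exists>i. x \<in> ball (c i) (\<rho> i)")
  case True
  then obtain i where i: "x \<in> ball (c i) (\<rho> i)" by blast
  have "onorm ((*v) (stretch_deriv x)) \<le> 2 * (norm (x - c i) / \<rho> i)"
  proof (rule onorm_bound)
    fix w
    have "stretch_deriv x *v w = (1 / \<rho> i) *\<^sub>R (radial_matrix (x - c i) *v w)"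
      unfolding stretch_deriv_in[OF i] by (rule scaleR_matrix_vector_assoc[symmetric])
    then have "norm (stretch_deriv x *v w) = norm (radial_matrix (x - c i) *v w) / \<rho> i"
      using \<rho>_pos[of i] by simp
    also have "\<dots> \<le> 2 * norm (x - c i) * norm w / \<rho> i"
      using \<rho>_pos[of i] by (intro divide_right_mono norm_radial_matrix_mult_le) simp
    finally show "norm (stretch_deriv x *v w) \<le> 2 * (norm (x - c i) / \<rho> i) * norm w" by simp
  qed (use \<rho>_pos[of i] in simp)
  then have "onorm ((*v) (stretch_deriv x)) ^ CARD('n) \<le> (2 * (norm (x - c i) / \<rho> i)) ^ CARD('n)"
    by (intro power_mono onorm_pos_le) auto
  also have "\<dots> = 2 ^ CARD('n) * (norm (x - c i) / \<rho> i) ^ CARD('n)" by (rule power_mult_distrib)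
  also have "\<dots> \<le> 2 ^ CARD('n) * det (stretch_deriv x)"
    using \<rho>_pos[of i] by (simp add: det_stretch_deriv_in[OF i])
  finally show ?thesis .
next
  case False
  then have 1: "stretch_deriv x = mat 1" using stretch_deriv_out by blast
  have "onorm ((*v) (stretch_deriv x)) \<le> 1"
    unfolding 1 by (rule onorm_bound) simp_all
  then have "onorm ((*v) (stretch_deriv x)) ^ CARD('n) \<le> 1"
    by (intro power_le_one onorm_pos_le) auto
  also have "(1::real) \<le> 2 ^ CARD('n)" by simp
  finally show ?thesis by (simp add: 1)
qed

section \<open>Differentiability almost everywhere\<close>

lemma has_derivative_stretch_in:
  assumes "x \<in> ball (c i) (\<rho> i)" "x \<noteq> c i"
  shows "(stretch has_derivative (*v) (stretch_deriv x)) (at x)"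
proof (rule has_derivative_transform_within_open)
  have "((\<lambda>y. y - c i) has_derivative (\<lambda>h. h)) (at x)"
    by (auto intro!: derivative_eq_intros)
  then have "((\<lambda>y. norm (y - c i) *\<^sub>R (y - c i)) has_derivative (*v) (radial_matrix (x - c i))) (at x)"
    by (rule has_derivative_compose) (use assms(2) in \<open>auto intro!: has_derivative_norm_scaleR\<close>)
  then have "((\<lambda>y. c i + (1 / \<rho> i) *\<^sub>R (norm (y - c i) *\<^sub>R (y - c i)))
    has_derivative (\<lambda>h. 0 + (1 / \<rho> i) *\<^sub>R (radial_matrix (x - c i) *v h))) (at x)"
    by (intro has_derivative_add has_derivative_const has_derivative_scaleR_right)
  moreover have "(\<lambda>h. 0 + (1 / \<rho> i) *\<^sub>R (radial_matrix (x - c i) *v h)) = (*v) (stretch_deriv x)"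
    unfolding stretch_deriv_in[OF assms(1)] by (simp only: scaleR_matrix_vector_assoc add_0)
  ultimately show "((\<lambda>y. c i + (1 / \<rho> i) *\<^sub>R (norm (y - c i) *\<^sub>R (y - c i)))
    has_derivative (*v) (stretch_deriv x)) (at x)"
    by simp
  show "c i + (1 / \<rho> i) *\<^sub>R (norm (y - c i) *\<^sub>R (y - c i)) = stretch y" if "y \<in> ball (c i) (\<rho> i)" for y
    using stretch_in[OF that] by simp
qed (use assms in auto)

text \<open>If all centers have distance at least \<open>\<delta>\<close> from \<open>x\<close>,
  only balls of radius at least \<open>\<delta> / 2\<close> can reach
  \<open>ball x (\<delta> / 2)\<close>. There are finitely many of them, their closures miss
  \<open>x\<close>, and so the map is the identity near \<open>x\<close>.\<close>

lemma has_derivative_stretch_out: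
  assumes fin: "\<And>\<delta>. 0 < \<delta> \<Longrightarrow> finite {i. \<delta> \<le> \<rho> i}"
    and x: "\<And>i. x \<notin> cball (c i) (\<rho> i)" "x \<notin> closure (range c)"
  shows "(stretch has_derivative (*v) (stretch_deriv x)) (at x)"
proof -
  obtain \<delta> where \<delta>: "0 < \<delta>" "\<And>i. \<delta> \<le> dist (c i) x"
    using x(2) unfolding closure_approachable by (auto simp: not_less)
  define V where "V = ball x (\<delta> / 2) - (\<Union>i\<in>{i. \<delta> / 2 \<le> \<rho> i}. cball (c i) (\<rho> i))"
  have "open V" unfolding V_def using fin[of "\<delta> / 2"] \<delta>(1)
    by (intro open_Diff open_ball closed_UN) auto
  have xV: "x \<in> V" using x(1) \<delta>(1) by (auto simp: V_def)
  have out: "y \<notin> ball (c i) (\<rho> i)" if "y \<in> V" for y i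
  proof (cases "\<delta> / 2 \<le> \<rho> i")
    case True
    then show ?thesis using that unfolding V_def by force
  next
    case False
    have "dist x y < \<delta> / 2" using that by (simp add: V_def)
    then show ?thesis using False dist_triangle[of "c i" x y] \<delta>(2)[of i] by (simp add: dist_commute)
  qed
  have "((\<lambda>y. y) has_derivative (\<lambda>h. h)) (at x)" by (rule has_derivative_ident)
  then have "(stretch has_derivative (\<lambda>h. h)) (at x)"
    by (rule has_derivative_transform_within_open[OF _ \<open>open V\<close> xV]) (metis out stretch_out)
  moreover have "stretch_deriv x = mat 1" using out[OF xV] by (rule stretch_deriv_out)
  moreover have "(*v) (mat 1 :: real^'n^'n) = (\<lambda>h. h)" by (intro ext matrix_vector_mul_lid)
  ultimately show ?thesis by simp
qed

lemma AE_has_derivative_stretch: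
  assumes fin: "\<And>\<delta>. 0 < \<delta> \<Longrightarrow> finite {i. \<delta> \<le> \<rho> i}" and neg: "negligible (closure (range c))"
  shows "AE x in lebesgue. (stretch has_derivative (*v) (stretch_deriv x)) (at x)"
proof -
  \<comment> \<open>The exceptional set: the centers with their accumulation points, and the
    spheres, where the radial derivative jumps from 2 to 1.\<close>
  let ?N = "closure (range c) \<union> (\<Union>i. sphere (c i) (\<rho> i))"
  have "negligible ?N"
    by (intro negligible_Un neg negligible_countable_Union) (auto simp: negligible_sphere)
  moreover have "(stretch has_derivative (*v) (stretch_deriv x)) (at x)" if "x \<notin> ?N" for x
  proof (cases "\<exists>i. x \<in> ball (c i) (\<rho> i)")
    case True
    then obtain i where i: "x \<in> ball (c i) (\<rho> i)" by blast
    have "c i \<in> closure (range c)" using closure_subset[of "range c"] by blast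
    then have "x \<noteq> c i" using that by blast
    then show ?thesis by (rule has_derivative_stretch_in[OF i])
  next
    case False
    have "x \<notin> cball (c i) (\<rho> i)" for i
      using that False by (force simp: order_le_less)
    moreover have "x \<notin> closure (range c)" using that by blast
    ultimately show ?thesis by (intro has_derivative_stretch_out[OF fin])
  qed
  ultimately show ?thesis
    unfolding eventually_ae_filter_negligible by blast
qed

lemma borel_measurable_stretch_deriv: "stretch_deriv \<in> borel_measurable lebesgue"
proof (rule measurable_completion, rule measurable_piecewise_restrict2)
  \<comment> \<open>The number 0 is reserved for the complement of the balls, which shifts the codes
    of the balls by one. Numbers that code no index get the empty set.\<close>
  define A where "A n = (case n of 0 \<Rightarrow> - (\<Union>i. ball (c i) (\<rho> i))
    | Suc k \<Rightarrow> (if \<exists>i::'i. to_nat i = k then ball (c (from_nat k)) (\<rho> (from_nat k)) else {}))" for n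
  show "A n \<in> sets lborel" for n
    by (auto simp: A_def split: nat.split intro!: borel_comp)
  have "x \<in> (\<Union>n. A n)" for x
  proof (cases "\<exists>i. x \<in> ball (c i) (\<rho> i)")
    case True
    then obtain i where "x \<in> ball (c i) (\<rho> i)" by blast
    then have "x \<in> A (Suc (to_nat i))" by (auto simp: A_def)
    then show ?thesis by blast
  next
    case False
    then have "x \<in> A 0" by (auto simp: A_def)
    then show ?thesis by blast
  qed
  then show "space lborel = (\<Union>n. A n)" by auto
  show "\<exists>h\<in>borel_measurable lborel. \<forall>x\<in>A n. stretch_deriv x = h x" for n
  proof (cases n)
    case 0
    then have "\<forall>x\<in>A n. stretch_deriv x = mat 1"
      using stretch_deriv_out by (auto simp: A_def simp del: mem_ball)
    then show ?thesis by (intro bexI[of _ "\<lambda>_. mat 1"]) auto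
  next
    case (Suc k)
    let ?i = "from_nat k"
    have "\<forall>x\<in>A n. stretch_deriv x = (1 / \<rho> ?i) *\<^sub>R radial_matrix (x - c ?i)"
      using stretch_deriv_in Suc by (auto simp: A_def simp del: mem_ball)
    then show ?thesis by (intro bexI[of _ "\<lambda>x. (1 / \<rho> ?i) *\<^sub>R radial_matrix (x - c ?i)"]) auto
  qed
qed

text \<open>A ball of radius at most half its distance to \<open>c i\<close> has all its points at comparable
  distance from \<open>c i\<close>, and the Jacobian is a power of that distance.\<close>
lemma det_stretch_deriv_comparable:
  assumes "range c \<subseteq> E" "2 * r < infdist x E" "y \<in> ball x r" "z \<in> ball x r"
  shows "det (stretch_deriv y) \<le> 3 ^ CARD('n) * det (stretch_deriv z)"
proof (cases "\<exists>i. z \<in> ball (c i) (\<rho> i)")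
  case False
  have "(3::real) ^ 1 \<le> 3 ^ CARD('n)" by (intro power_increasing) (auto simp: Suc_leI)
  moreover have "det (stretch_deriv z) = 1" using False det_stretch_deriv_out by blast
  ultimately show ?thesis using det_stretch_deriv_le[of y] by simp
next
  case True
  then obtain i where i: "z \<in> ball (c i) (\<rho> i)" by blast
  have "c i \<in> E" using assms(1) by blast
  then have "2 * r < dist x (c i)"
    using assms(2) infdist_le[of "c i" E x] by linarith
  moreover have "dist x y < r" "dist x z < r" using assms by auto
  \<comment> \<open>With \<open>D = dist x (c i) > 2 * r\<close>, the two distances lie between
    \<open>D - r\<close> and \<open>D + r\<close>, and
    \<open>D + r \<le> 3 * (D - r)\<close>.\<close>
  ultimately have "dist y (c i) \<le> 3 * dist z (c i)"
    using dist_triangle[of y "c i" x] dist_triangle[of x "c i" z]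
    by (simp add: dist_commute)
  then have yz: "norm (y - c i) \<le> 3 * norm (z - c i)" by (simp add: dist_norm)
  show ?thesis
  proof (cases "y \<in> ball (c i) (\<rho> i)")
    case True
    have "norm (y - c i) / \<rho> i \<le> 3 * (norm (z - c i) / \<rho> i)"
      using divide_right_mono[OF yz less_imp_le[OF \<rho>_pos[of i]]] by simp
    then have "(norm (y - c i) / \<rho> i) ^ CARD('n) \<le> (3 * (norm (z - c i) / \<rho> i)) ^ CARD('n)"
      using \<rho>_pos[of i] by (intro power_mono) auto
    then show ?thesis
      unfolding det_stretch_deriv_in[OF True] det_stretch_deriv_in[OF i] power_mult_distrib by linarith
  next
    case False
    \<comment> \<open>Only the global bound 2 is used for \<open>y\<close>, which may lie in another
      ball; that \<open>y\<close> is outside keeps \<open>z\<close> away from the center.\<close>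
    then have "\<rho> i \<le> 3 * norm (z - c i)" using yz unfolding in_ball_norm by linarith
    then have "1 \<le> 3 * (norm (z - c i) / \<rho> i)"
      using \<rho>_pos[of i] by (simp add: divide_simps)
    then have "1 \<le> (3 * (norm (z - c i) / \<rho> i)) ^ CARD('n)" by (rule one_le_power)
    then have "2 \<le> 3 ^ CARD('n) * det (stretch_deriv z)"
      unfolding det_stretch_deriv_in[OF i] power_mult_distrib by linarith
    then show ?thesis using det_stretch_deriv_le[of y] by linarith
  qed
qed

text \<open>The Jacobian is comparable at any two points of an admissible ball, so its mean is at
  most a constant times each of its values on the ball, and hence at most that constant times the
  essential infimum.\<close>

lemma muckenhoupt_A1_stretch:
  assumes "range c \<subseteq> E"
  shows "muckenhoupt_A1 E (\<lambda>x. det (stretch_deriv x))"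
  unfolding muckenhoupt_A1_def
proof (intro conjI exI[of _ "3 ^ CARD('n)"] allI impI)
  have "continuous_on UNIV (det :: real^'n^'n \<Rightarrow> real)"
    unfolding det_def by (intro continuous_intros)
  then show "(\<lambda>x. det (stretch_deriv x)) \<in> borel_measurable lebesgue"
    by (intro measurable_compose[OF borel_measurable_stretch_deriv] borel_measurable_continuous_onI)
  show "AE x in lebesgue. 0 \<le> det (stretch_deriv x)"
    using det_stretch_deriv_nonneg by simp
  fix x r assume "0 < r \<and> (E = {} \<or> 2 * r < infdist x E)"
  \<comment> \<open>\<open>E\<close> contains the centers, so the alternative \<open>E = {}\<close>
    is excluded.\<close>
  then have r: "0 < r" "2 * r < infdist x E" using assms by auto
  let ?J = "\<lambda>z. ennreal (det (stretch_deriv z))"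
  let ?C = "ennreal (3 ^ CARD('n))"
  define a where "a = (\<integral>\<^sup>+z\<in>ball x r. ?J z \<partial>lebesgue) / emeasure lebesgue (ball x r)"
  have eml: "emeasure lebesgue (ball x r) = emeasure lborel (ball x r)" by simp
  have vol: "0 < emeasure lebesgue (ball x r)" "emeasure lebesgue (ball x r) < top"
    unfolding eml using r(1) emeasure_lborel_ball_finite[of x r]
    by (simp_all add: emeasure_ball)
  have le: "a \<le> ?C * ?J z" if z: "z \<in> ball x r" for z
  proof -
    have "(\<integral>\<^sup>+y\<in>ball x r. ?J y \<partial>lebesgue)
      \<le> (\<integral>\<^sup>+y. ?C * ?J z * indicator (ball x r) y \<partial>lebesgue)"
    proof (intro nn_integral_mono)
      fix y
      have "?J y \<le> ?C * ?J z" if "y \<in> ball x r"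
        using det_stretch_deriv_comparable[OF assms r(2) that z] det_stretch_deriv_nonneg[of z]
        by (simp add: ennreal_leI flip: ennreal_mult)
      then show "?J y * indicator (ball x r) y \<le> ?C * ?J z * indicator (ball x r) y"
        by (auto simp: indicator_def simp del: mem_ball)
    qed
    also have "\<dots> = ?C * ?J z * emeasure lebesgue (ball x r)"
      by (rule nn_integral_cmult_indicator) simp
    finally show ?thesis unfolding a_def
      using vol(1) by (intro divide_le_posI_ennreal) (auto simp: mult.commute)
  qed
  have C: "0 < ?C" "?C \<noteq> 0" "?C \<noteq> top" by simp_all
  have "a / ?C \<le> Liminf (ae_filter (restrict_space lebesgue (ball x r))) ?J"
  proof (rule Liminf_bounded, rule AE_I2)
    fix z assume "z \<in> space (restrict_space lebesgue (ball x r))"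
    then have "z \<in> ball x r" by (simp add: space_restrict_space)
    from le[OF this] show "a / ?C \<le> ?J z"
      using C by (intro divide_le_posI_ennreal) (auto simp: mult.commute)
  qed
  then have "?C * (a / ?C) \<le>
    ?C * Liminf (ae_filter (restrict_space lebesgue (ball x r))) ?J"
    by (rule mult_left_mono) simp
  moreover have "?C * (a / ?C) = a"
    using C by (metis ennreal_times_divide mult.commute ennreal_mult_divide_eq)
  ultimately show "(\<integral>\<^sup>+z\<in>ball x r. ?J z \<partial>lebesgue) / emeasure lebesgue (ball x r)
    \<le> ?C * Liminf (ae_filter (restrict_space lebesgue (ball x r))) ?J"
    by (simp add: a_def)
qed simp

lemma quasiconformal_stretch:
  assumes "W11_loc_derivative stretch stretch_deriv"
  shows "quasiconformal stretch"
proof -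
  have "(1::real) \<le> 2 ^ CARD('n)" by simp
  then show ?thesis
    unfolding quasiconformal_def
    using homeomorphism_stretch assms onorm_stretch_deriv_le by (blast intro: AE_I2)
qed

end

section \<open>The energy of tent functions\<close>

lemma power_two_bracket:
  assumes "1 \<le> (y::real)"
  obtains j :: nat where "2 ^ j \<le> y" "y < 2 ^ Suc j"
proof -
  obtain m :: nat where m: "y < 2 ^ m" using real_arch_pow[of 2 y] by auto
  define n where "n = (LEAST n. y < 2 ^ n)"
  have n: "y < 2 ^ n" unfolding n_def using m by (rule LeastI)
  then obtain j where j: "n = Suc j" using assms by (cases n) auto
  then have "\<not> y < 2 ^ j" using not_less_Least[of j "\<lambda>n. y < 2 ^ n"] by (simp add: n_def)
  then show thesis using that[of j] n j by (simp add: not_less)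
qed

text \<open>Majorises, as a function of \<open>z = x - y\<close>, the energy density of any function
  with values in the unit interval and Lipschitz constant \<open>1 / t\<close>. Its value at the
  origin is 0 by division by zero.\<close>

definition truncated_kernel :: "real \<Rightarrow> real \<Rightarrow> 'a::euclidean_space \<Rightarrow> real" where
  "truncated_kernel \<alpha> t z = min 1 ((norm z / t)\<^sup>2) / norm z powr (real DIM('a) + 2 * \<alpha>)"

lemma borel_measurable_truncated_kernel [measurable]:
  "truncated_kernel \<alpha> t \<in> borel_measurable borel"
  unfolding truncated_kernel_def[abs_def] by measurable

text \<open>Dyadic shells around radius \<open>t\<close>, inwards in the first summand and outwards
  in the second; the factor \<open>(1/4) ^ j\<close> is the quadratic gain of the numerator inside.
  Shells are enlarged to balls because ball volumes are explicit.\<close>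

lemma truncated_kernel_dyadic:
  fixes z :: "'a::euclidean_space"
  assumes "0 < t" "0 < \<alpha>" "z \<noteq> 0"
  shows "\<exists>j. truncated_kernel \<alpha> t z
    \<le> (1/4) ^ j * (t * (1/2) ^ j / 2) powr (- (real DIM('a) + 2 * \<alpha>)) * indicator (ball 0 (2 * t * (1/2) ^ j)) z
      + (t * 2 ^ j) powr (- (real DIM('a) + 2 * \<alpha>)) * indicator (ball 0 (2 * t * 2 ^ j)) z"
proof -
  let ?p = "real DIM('a) + 2 * \<alpha>"
  have p: "0 < ?p" using assms by (simp add: add_pos_nonneg)
  show ?thesis
  proof (cases "norm z < t")
    case True
    then have "1 \<le> t / norm z" using assms by simp
    then obtain j where j: "2 ^ j \<le> t / norm z" "t / norm z < 2 ^ Suc j"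
      by (rule power_two_bracket)
    have up: "norm z \<le> t * (1/2) ^ j" using j(1) assms by (simp add: field_simps power_one_over)
    have lo: "t * (1/2) ^ j / 2 \<le> norm z" using j(2) assms by (simp add: field_simps power_one_over)
    have "norm z / t \<le> (1/2) ^ j" using up assms by (simp add: field_simps)
    then have "(norm z / t)\<^sup>2 \<le> ((1/2) ^ j)\<^sup>2" using assms by (intro power_mono) auto
    also have "\<dots> = (1/4) ^ j" by (simp add: power2_eq_square flip: power_mult_distrib)
    finally have m: "min 1 ((norm z / t)\<^sup>2) \<le> (1/4) ^ j" by simp
    have pw: "norm z powr (- ?p) \<le> (t * (1/2) ^ j / 2) powr (- ?p)"
      using lo assms p by (intro powr_mono2') auto
    have "truncated_kernel \<alpha> t z = min 1 ((norm z / t)\<^sup>2) * norm z powr (- ?p)"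
      by (simp only: truncated_kernel_def powr_minus divide_inverse)
    also have "\<dots> \<le> (1/4) ^ j * (t * (1/2) ^ j / 2) powr (- ?p)"
      using m pw by (intro mult_mono) auto
    finally have main: "truncated_kernel \<alpha> t z \<le> (1/4) ^ j * (t * (1/2) ^ j / 2) powr (- ?p)" .
    have "0 < t * (1/2) ^ j" using assms by simp
    then have "z \<in> ball 0 (2 * t * (1/2) ^ j)" using up by simp
    then show ?thesis using main by (intro exI[of _ j]) (simp add: add_increasing2)
  next
    case False
    then have "1 \<le> norm z / t" using assms by simp
    then obtain j where j: "2 ^ j \<le> norm z / t" "norm z / t < 2 ^ Suc j"
      by (rule power_two_bracket)
    have up: "norm z < 2 * t * 2 ^ j" using j(2) assms by (simp add: field_simps)
    have lo: "t * 2 ^ j \<le> norm z" using j(1) assms by (simp add: field_simps)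
    have pw: "norm z powr (- ?p) \<le> (t * 2 ^ j) powr (- ?p)"
      using lo assms p by (intro powr_mono2') auto
    have "truncated_kernel \<alpha> t z = min 1 ((norm z / t)\<^sup>2) * norm z powr (- ?p)"
      by (simp only: truncated_kernel_def powr_minus divide_inverse)
    also have "\<dots> \<le> 1 * (t * 2 ^ j) powr (- ?p)"
      using pw by (intro mult_mono) auto
    finally have main: "truncated_kernel \<alpha> t z \<le> (t * 2 ^ j) powr (- ?p)" by simp
    have "z \<in> ball 0 (2 * t * 2 ^ j)" using up by simp
    then show ?thesis using main by (intro exI[of _ j]) (simp add: add_increasing)
  qed
qed

text \<open>Summing the shells gives two geometric series. The inner one has ratio \<open>q1\<close>
  and converges because \<open>\<alpha> < 1\<close>; the outer one has ratio \<open>q2\<close> and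
  converges because \<open>0 < \<alpha>\<close>. The power of \<open>t\<close> is forced by
  scaling.\<close>

lemma nn_integral_truncated_kernel:
  assumes \<alpha>: "0 < \<alpha>" "\<alpha> < 1"
  shows "\<exists>C>0. \<forall>t>0. (\<integral>\<^sup>+z. ennreal (truncated_kernel \<alpha> t (z::'a::euclidean_space)) \<partial>lborel)
    \<le> ennreal (C * t powr (- 2 * \<alpha>))"
proof -
  let ?n = "DIM('a)"
  define p where "p = real ?n + 2 * \<alpha>"
  define V where "V = unit_ball_vol (real ?n)"
  have V: "0 < V" unfolding V_def by (rule unit_ball_vol_pos) simp
  define q1 q2 where "q1 = 2 powr (2 * \<alpha> - 2)" and "q2 = 2 powr (- 2 * \<alpha>)"
  have q1: "0 < q1" "q1 < 1" and q2: "0 < q2" "q2 < 1"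
    using \<alpha> by (auto simp: q1_def q2_def intro!: powr_less_one)
  \<comment> \<open>\<open>2 ^ ?n\<close> comes from the doubled radius of the balls,
    \<open>2 powr p\<close> from the lower bound for \<open>norm z\<close>, which is half the inner
    shell's outer radius.\<close>
  define A B where "A = V * 2 ^ ?n * 2 powr p" and "B = V * 2 ^ ?n"
  have AB: "0 < A" "0 < B" using V by (auto simp: A_def B_def)
  define C where "C = A / (1 - q1) + B / (1 - q2)"
  have "0 < C" using AB q1 q2 by (auto simp: C_def intro!: add_pos_pos divide_pos_pos)
  moreover have "(\<integral>\<^sup>+z. ennreal (truncated_kernel \<alpha> t (z::'a)) \<partial>lborel) \<le> ennreal (C * t powr (- 2 * \<alpha>))"
    if t: "0 < t" for t
  proof -
    define a b where "a j = (1/4) ^ j * (t * (1/2) ^ j / 2) powr (- p)"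
      and "b j = (t * 2 ^ j) powr (- p)" for j :: nat
    have ab: "0 \<le> a j" "0 \<le> b j" for j by (auto simp: a_def b_def)
    define g where "g j z = ennreal (a j) * indicator (ball 0 (2 * t * (1/2) ^ j)) z
      + ennreal (b j) * indicator (ball 0 (2 * t * 2 ^ j)) z" for j and z :: 'a
    have [measurable]: "ball (0::'a) r \<in> sets borel" for r by simp
    have gm [measurable]: "g j \<in> borel_measurable borel" for j unfolding g_def by measurable
    have pt: "ennreal (truncated_kernel \<alpha> t z) \<le> (\<Sum>j. g j z)" for z :: 'a
    proof (cases "z = 0")
      case True
      then show ?thesis by (simp add: truncated_kernel_def)
    next
      case False
      then obtain j where j: "truncated_kernel \<alpha> t z
        \<le> a j * indicator (ball 0 (2 * t * (1/2) ^ j)) z + b j * indicator (ball 0 (2 * t * 2 ^ j)) z"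
        using truncated_kernel_dyadic[OF t \<alpha>(1) False] unfolding a_def b_def p_def by blast
      have "ennreal (truncated_kernel \<alpha> t z) \<le> ennreal (a j * indicator (ball 0 (2 * t * (1/2) ^ j)) z
        + b j * indicator (ball 0 (2 * t * 2 ^ j)) z)"
        using j by (rule ennreal_leI)
      also have "\<dots> = g j z"
        using ab[of j] by (simp add: g_def ennreal_plus ennreal_mult ennreal_indicator)
      also have "\<dots> \<le> (\<Sum>j. g j z)"
        using sum_le_suminf[OF summableI, of "{j}" "\<lambda>j. g j z"] by simp
      finally show ?thesis .
    qed
    have ball: "emeasure lborel (ball (0::'a) r) = ennreal (V * r ^ ?n)" if "0 \<le> r" for r
      using that by (simp add: emeasure_ball V_def)
    have int: "(\<integral>\<^sup>+z. g j z \<partial>lborel) = ennreal (t powr (- 2 * \<alpha>) * (A * q1 ^ j + B * q2 ^ j))" for j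
    proof -
      have half: "(1/2::real) ^ j = 2 powr (- real j)"
        by (simp add: powr_minus powr_realpow power_one_over inverse_eq_divide)
      have quarter: "(1/4::real) ^ j = 2 powr (- 2 * real j)"
      proof -
        have "(1/4::real) ^ j = (1/2) ^ j * (1/2) ^ j" by (simp flip: power_mult_distrib)
        then show ?thesis by (simp add: half flip: powr_add)
      qed
      have dbl: "(2::real) ^ j = 2 powr real j" by (simp add: powr_realpow)
      have rn: "x ^ ?n = x powr real ?n" if "0 < x" for x :: real using that by (simp add: powr_realpow)
      have A': "a j * (V * (2 * t * (1/2) ^ j) ^ ?n) = t powr (- 2 * \<alpha>) * (A * q1 ^ j)"
      proof -
        have 1: "(t * 2 powr (- real j) / 2) powr (- p) = t powr (- p) * 2 powr (real j * p) * 2 powr p"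
        proof -
          have "t * 2 powr (- real j) / 2 = t * (2 powr (- real j) * 2 powr (- 1))"
            by (simp add: powr_minus)
          then have "(t * 2 powr (- real j) / 2) powr (- p)
            = t powr (- p) * ((2 powr (- real j)) powr (- p) * (2 powr (- 1)) powr (- p))"
            using t by (simp only: powr_mult less_imp_le powr_ge_zero mult_nonneg_nonneg)
          then show ?thesis
            by (simp only: powr_powr mult_minus_left mult_minus_right minus_minus mult_1_left mult.assoc)
        qed
        have 2: "(2 * t * 2 powr (- real j)) ^ ?n = 2 ^ ?n * t powr real ?n * 2 powr (- real j * real ?n)"
          using t by (simp add: power_mult_distrib rn powr_powr)
        have 3: "q1 ^ j = 2 powr ((2 * \<alpha> - 2) * real j)" unfolding q1_def
          by (simp add: powr_powr flip: powr_realpow)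
        have "a j * (V * (2 * t * (1/2) ^ j) ^ ?n) = V * 2 ^ ?n * 2 powr p *
          (t powr (- p) * t powr real ?n) * (2 powr (- 2 * real j) * 2 powr (real j * p) * 2 powr (- real j * real ?n))"
          unfolding a_def half quarter 1 2 by (simp only: mult_ac)
        also have "t powr (- p) * t powr real ?n = t powr (- 2 * \<alpha>)"
          by (simp add: p_def flip: powr_add)
        also have "2 powr (- 2 * real j) * 2 powr (real j * p) * 2 powr (- real j * real ?n) = q1 ^ j"
          unfolding 3 powr_add[symmetric] p_def by (simp add: algebra_simps)
        finally show ?thesis unfolding A_def by (simp only: mult_ac)
      qed
      have B': "b j * (V * (2 * t * 2 ^ j) ^ ?n) = t powr (- 2 * \<alpha>) * (B * q2 ^ j)"
      proof -
        have 1: "(t * 2 powr real j) powr (- p) = t powr (- p) * 2 powr (- real j * p)"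
          using t by (simp add: powr_mult powr_powr)
        have 2: "(2 * t * 2 powr real j) ^ ?n = 2 ^ ?n * t powr real ?n * 2 powr (real j * real ?n)"
          using t by (simp add: power_mult_distrib rn powr_powr)
        have 3: "q2 ^ j = 2 powr ((- 2 * \<alpha>) * real j)" unfolding q2_def
          by (simp add: powr_powr flip: powr_realpow)
        have "b j * (V * (2 * t * 2 ^ j) ^ ?n) = V * 2 ^ ?n *
          (t powr (- p) * t powr real ?n) * (2 powr (- real j * p) * 2 powr (real j * real ?n))"
          unfolding b_def dbl 1 2 by (simp only: mult_ac)
        also have "t powr (- p) * t powr real ?n = t powr (- 2 * \<alpha>)"
          by (simp add: p_def flip: powr_add)
        also have "2 powr (- real j * p) * 2 powr (real j * real ?n) = q2 ^ j"
          unfolding 3 powr_add[symmetric] p_def by (simp add: algebra_simps)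
        finally show ?thesis unfolding B_def by (simp only: mult_ac)
      qed
      have "(\<integral>\<^sup>+z. g j z \<partial>lborel) = ennreal (a j) * emeasure lborel (ball (0::'a) (2 * t * (1/2) ^ j))
        + ennreal (b j) * emeasure lborel (ball (0::'a) (2 * t * 2 ^ j))"
        unfolding g_def by (subst nn_integral_add) (auto simp: nn_integral_cmult_indicator)
      also have "\<dots> = ennreal (a j * (V * (2 * t * (1/2) ^ j) ^ ?n) + b j * (V * (2 * t * 2 ^ j) ^ ?n))"
        using ab[of j] V t by (simp add: ball flip: ennreal_mult ennreal_plus)
      also have "\<dots> = ennreal (t powr (- 2 * \<alpha>) * (A * q1 ^ j + B * q2 ^ j))"
        unfolding A' B' by (simp only: distrib_left)
      finally show ?thesis .
    qed
    have sums: "(\<lambda>j. t powr (- 2 * \<alpha>) * (A * q1 ^ j + B * q2 ^ j)) sums (t powr (- 2 * \<alpha>) * (A * (1 / (1 - q1)) + B * (1 / (1 - q2))))"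
      using q1 q2 by (intro sums_mult sums_add geometric_sums) auto
    have "(\<integral>\<^sup>+z. ennreal (truncated_kernel \<alpha> t (z::'a)) \<partial>lborel) \<le> (\<integral>\<^sup>+z. (\<Sum>j. g j z) \<partial>lborel)"
      by (intro nn_integral_mono pt)
    also have "\<dots> = (\<Sum>j. \<integral>\<^sup>+z. g j z \<partial>lborel)"
      by (rule nn_integral_suminf) simp
    also have "\<dots> = ennreal (\<Sum>j. t powr (- 2 * \<alpha>) * (A * q1 ^ j + B * q2 ^ j))"
      unfolding int using AB q1 q2 sums_summable[OF sums]
      by (intro suminf_ennreal2) auto
    also have "\<dots> = ennreal (C * t powr (- 2 * \<alpha>))"
      using sums_unique[OF sums] by (simp add: C_def mult.commute)
    finally show ?thesis .
  qed
  ultimately show ?thesis by blast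
qed

section \<open>Tent functions and their Q-norms\<close>

lemma sqrt_ennreal_mono:
  assumes "a \<le> b"
  shows "sqrt_ennreal a \<le> sqrt_ennreal b"
proof (cases "b = \<infinity>")
  case False
  then have "b < top" by (simp add: less_top)
  then show ?thesis
    using assms False by (auto simp: sqrt_ennreal_def top_unique intro!: ennreal_leI enn2real_mono)
qed (simp add: sqrt_ennreal_def)

lemma sqrt_ennreal_ennreal: "0 \<le> a \<Longrightarrow> sqrt_ennreal (ennreal a) = ennreal (sqrt a)"
  by (simp add: sqrt_ennreal_def)

text \<open>Written with the distance to the set, so that the Lipschitz constant is
  \<open>1 / t\<close> whatever the spacing of the points. For a nonempty finite set of points at
  mutual distance at least \<open>2 * t\<close> it is the sum of the single bumps.\<close>

definition tent :: "'a::metric_space set \<Rightarrow> real \<Rightarrow> 'a \<Rightarrow> real" where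
  "tent A t x = max 0 (1 - infdist x A / t)"

lemma tent_bounds: "0 < t \<Longrightarrow> 0 \<le> tent A t x \<and> tent A t x \<le> 1"
  by (simp add: tent_def infdist_nonneg)

lemma continuous_on_tent: "0 < t \<Longrightarrow> continuous_on S (tent A t)"
  unfolding tent_def[abs_def] by (intro continuous_intros) auto

lemma tent_diff_le:
  assumes "0 < t"
  shows "\<bar>tent A t x - tent A t y\<bar> \<le> min 1 (dist x y / t)"
proof -
  have "\<bar>infdist x A / t - infdist y A / t\<bar> \<le> dist x y / t"
    using infdist_triangle_abs[of x A y] assms
    by (simp add: divide_right_mono flip: diff_divide_distrib)
  then have "\<bar>tent A t x - tent A t y\<bar> \<le> dist x y / t"
    unfolding tent_def by linarith
  moreover have "\<bar>tent A t x - tent A t y\<bar> \<le> 1"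
    using tent_bounds[OF assms, of A x] tent_bounds[OF assms, of A y] by linarith
  ultimately show ?thesis by simp
qed

lemma tent_eq_0: "0 < t \<Longrightarrow> t \<le> infdist x A \<Longrightarrow> tent A t x = 0"
  by (simp add: tent_def)

lemma nn_integral_lborel_translate:
  fixes k :: "'a::euclidean_space \<Rightarrow> ennreal"
  assumes [measurable]: "k \<in> borel_measurable borel"
  shows "(\<integral>\<^sup>+y. k (c + y) \<partial>lborel) = (\<integral>\<^sup>+y. k y \<partial>lborel)"
proof -
  have "(\<integral>\<^sup>+y. k y \<partial>lborel) = (\<integral>\<^sup>+y. k y \<partial>distr lborel borel ((+) c))"
    by (simp add: lborel_distr_plus)
  also have "\<dots> = (\<integral>\<^sup>+y. k (c + y) \<partial>lborel)" by (rule nn_integral_distr) auto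
  finally show ?thesis by simp
qed

text \<open>The integrand vanishes unless \<open>x\<close> or \<open>y\<close> lies in the support of the tent function.\<close>
lemma tent_energy_le:
  fixes A :: "(real^'n::finite) set"
  assumes t: "0 < t"
    and I: "(\<integral>\<^sup>+z. ennreal (truncated_kernel \<alpha> t (z::real^'n)) \<partial>lborel) \<le> I"
    and [measurable]: "B \<in> sets borel"
  shows "(\<integral>\<^sup>+x\<in>B. (\<integral>\<^sup>+y\<in>B.
        ennreal (\<bar>tent A t x - tent A t y\<bar>\<^sup>2 / norm (x - y) powr (real CARD('n) + 2 * \<alpha>))
      \<partial>lebesgue) \<partial>lebesgue) \<le> 2 * I * emeasure lborel (B \<inter> {x. infdist x A < t})"
proof -
  define N where "N = B \<inter> {x. infdist x A < t}"
  have "open {x. infdist x A < t}" by (intro open_Collect_less continuous_intros)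
  then have Nm [measurable]: "N \<in> sets borel" unfolding N_def by auto
  define k where "k z = ennreal (truncated_kernel \<alpha> t (z::real^'n))" for z
  have km [measurable]: "k \<in> borel_measurable borel" unfolding k_def by measurable
  have ksym: "k (x - y) = k (y - x)" for x y by (simp add: k_def truncated_kernel_def norm_minus_commute)
  have kint: "(\<integral>\<^sup>+y. k (y - x) \<partial>lborel) \<le> I" for x
    using nn_integral_lborel_translate[OF km, of "- x"] I by (simp add: k_def)
  \<comment> \<open>Each pair with nonzero integrand is charged to a point in the support; the
    kernel then depends on the other point only through the difference.\<close>
  have pt: "ennreal (\<bar>tent A t x - tent A t y\<bar>\<^sup>2 / norm (x - y) powr (real CARD('n) + 2 * \<alpha>)) * indicator B y * indicator B x
    \<le> indicator N x * k (y - x) + indicator N y * k (x - y)" for x y :: "real^'n"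
  proof (cases "x \<in> B \<and> y \<in> B \<and> (x \<in> N \<or> y \<in> N)")
    case True
    have "\<bar>tent A t x - tent A t y\<bar>\<^sup>2 \<le> (min 1 (norm (x - y) / t))\<^sup>2"
      using tent_diff_le[OF t, of A x y] by (intro power_mono) (auto simp: dist_norm)
    also have "\<dots> \<le> min 1 ((norm (x - y) / t)\<^sup>2)"
      using t by (auto simp: min_def power_le_one abs_square_le_1)
    finally have "\<bar>tent A t x - tent A t y\<bar>\<^sup>2 / norm (x - y) powr (real CARD('n) + 2 * \<alpha>)
      \<le> truncated_kernel \<alpha> t (x - y)"
      unfolding truncated_kernel_def by (simp add: divide_right_mono)
    then have "ennreal (\<bar>tent A t x - tent A t y\<bar>\<^sup>2 / norm (x - y) powr (real CARD('n) + 2 * \<alpha>)) \<le> k (x - y)"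
      unfolding k_def by (rule ennreal_leI)
    then show ?thesis using True ksym[of x y] by (auto simp: add_increasing add_increasing2)
  next
    case False
    have "t \<le> infdist z A" if "z \<in> B" "z \<notin> N" for z using that by (auto simp: N_def)
    then show ?thesis using tent_eq_0[OF t, of x A] tent_eq_0[OF t, of y A] False
      by (auto simp: indicator_def)
  qed
  have "(\<integral>\<^sup>+x\<in>B. (\<integral>\<^sup>+y\<in>B.
        ennreal (\<bar>tent A t x - tent A t y\<bar>\<^sup>2 / norm (x - y) powr (real CARD('n) + 2 * \<alpha>))
      \<partial>lebesgue) \<partial>lebesgue)
    = (\<integral>\<^sup>+x. (\<integral>\<^sup>+y. ennreal (\<bar>tent A t x - tent A t y\<bar>\<^sup>2 / norm (x - y) powr (real CARD('n) + 2 * \<alpha>)) * indicator B y * indicator B x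
      \<partial>lborel) \<partial>lborel)"
    unfolding nn_integral_completion
  proof (intro nn_integral_cong)
    fix x :: "real^'n"
    show "(\<integral>\<^sup>+y\<in>B. ennreal (\<bar>tent A t x - tent A t y\<bar>\<^sup>2 / norm (x - y) powr (real CARD('n) + 2 * \<alpha>)) \<partial>lborel) * indicator B x
      = (\<integral>\<^sup>+y. ennreal (\<bar>tent A t x - tent A t y\<bar>\<^sup>2 / norm (x - y) powr (real CARD('n) + 2 * \<alpha>)) * indicator B y * indicator B x \<partial>lborel)"
      by (cases "x \<in> B") auto
  qed
  also have "\<dots> \<le> (\<integral>\<^sup>+x. (\<integral>\<^sup>+y. indicator N x * k (y - x) + indicator N y * k (x - y) \<partial>lborel) \<partial>lborel)"
    by (intro nn_integral_mono pt)
  also have "\<dots> = (\<integral>\<^sup>+x. (\<integral>\<^sup>+y. indicator N x * k (y - x) \<partial>lborel) \<partial>lborel)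
      + (\<integral>\<^sup>+x. (\<integral>\<^sup>+y. indicator N y * k (x - y) \<partial>lborel) \<partial>lborel)"
    by (subst nn_integral_add[symmetric]) (auto simp: nn_integral_add intro!: nn_integral_cong)
  \<comment> \<open>The order is exchanged so that the inner integral runs over the free variable in
    both terms.\<close>
  also have "(\<integral>\<^sup>+x. (\<integral>\<^sup>+y. indicator N y * k (x - y) \<partial>lborel) \<partial>lborel)
      = (\<integral>\<^sup>+y. (\<integral>\<^sup>+x. indicator N y * k (x - y) \<partial>lborel) \<partial>lborel)"
    by (rule lborel_pair.Fubini') measurable
  also have "(\<integral>\<^sup>+x. (\<integral>\<^sup>+y. indicator N x * k (y - x) \<partial>lborel) \<partial>lborel)
      + (\<integral>\<^sup>+y. (\<integral>\<^sup>+x. indicator N y * k (x - y) \<partial>lborel) \<partial>lborel)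
      = 2 * (\<integral>\<^sup>+x. indicator N x * (\<integral>\<^sup>+y. k (y - x) \<partial>lborel) \<partial>lborel)"
    by (simp add: nn_integral_cmult mult_2)
  also have "\<dots> \<le> 2 * (\<integral>\<^sup>+x. I * indicator N x \<partial>lborel)"
    using kint by (intro mult_left_mono nn_integral_mono) (auto simp: indicator_def)
  also have "\<dots> = 2 * I * emeasure lborel N"
    by (simp add: nn_integral_cmult_indicator mult.assoc)
  finally show ?thesis unfolding N_def .
qed

text \<open>The energy is at most a constant times \<open>t powr (- 2 * \<alpha>)\<close> times the
  volume of the support in the ball. For \<open>r < t\<close> the volume of the whole ball gives the
  bound 1; for \<open>t \<le> r\<close> the support is covered by balls of radius \<open>t\<close>
  around points of \<open>A\<close>, all within distance \<open>2 * r\<close> of the center of the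
  ball, and this gives \<open>b\<close>.\<close>

lemma Q_norm_tent_le:
  assumes \<alpha>: "0 < \<alpha>" "\<alpha> < 1"
  shows "\<exists>C>0. \<forall>(A::(real^'n::finite) set) t b. finite A \<and> A \<noteq> {} \<and> 0 < t \<and>
      (\<forall>x r. t \<le> r \<longrightarrow> r powr (2 * \<alpha> - real CARD('n)) * t powr (real CARD('n) - 2 * \<alpha>)
        * real (card (A \<inter> ball x (2 * r))) \<le> b)
    \<longrightarrow> Q_norm \<alpha> (tent A t) \<le> ennreal (sqrt (C * max 1 b))"
proof -
  obtain C0 where C0: "0 < C0" and I: "\<And>t. 0 < t \<Longrightarrow>
    (\<integral>\<^sup>+z. ennreal (truncated_kernel \<alpha> t (z::real^'n)) \<partial>lborel) \<le> ennreal (C0 * t powr (- 2 * \<alpha>))"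
    using nn_integral_truncated_kernel[OF \<alpha>, where ?'a = "real^'n"] by blast
  let ?n = "CARD('n)"
  define V where "V = unit_ball_vol (real ?n)"
  have V: "0 < V" unfolding V_def by (rule unit_ball_vol_pos) simp
  have ball: "emeasure lborel (ball (x::real^'n) r) = ennreal (V * r powr ?n)" if "0 < r" for r x
    using that by (simp add: emeasure_ball V_def powr_realpow)
  define C where "C = 2 * C0 * V"
  have C: "0 < C" using C0 V by (simp add: C_def)
  have "Q_norm \<alpha> (tent A t) \<le> ennreal (sqrt (C * max 1 b))"
    if A: "finite A" "A \<noteq> {}" and t: "0 < t"
      and b: "\<And>x r. t \<le> r \<Longrightarrow> r powr (2 * \<alpha> - real ?n) * t powr (real ?n - 2 * \<alpha>)
        * real (card (A \<inter> ball x (2 * r))) \<le> b" for A :: "(real^'n) set" and t b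
    unfolding Q_norm_def
  proof (rule SUP_least, clarify)
    fix x0 :: "real^'n" and r :: real assume r: "0 < r"
    define N where "N = ball x0 r \<inter> {x. infdist x A < t}"
    have vol: "\<exists>m\<ge>0. emeasure lborel N \<le> ennreal (V * m)
      \<and> r powr (2 * \<alpha> - real ?n) * t powr (- 2 * \<alpha>) * m \<le> max 1 b"
    proof (cases "r < t")
      case True
      have "emeasure lborel N \<le> emeasure lborel (ball x0 r)"
        unfolding N_def by (intro emeasure_mono) auto
      also have "\<dots> = ennreal (V * r powr ?n)" by (rule ball[OF r])
      finally have 1: "emeasure lborel N \<le> ennreal (V * r powr ?n)" .
      have "r powr (2 * \<alpha> - real ?n) * t powr (- 2 * \<alpha>) * r powr ?n = r powr (2 * \<alpha>) * t powr (- 2 * \<alpha>)"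
        using r by (simp add: mult.commute mult.left_commute flip: powr_add)
      also have "\<dots> \<le> t powr (2 * \<alpha>) * t powr (- 2 * \<alpha>)"
        using True r \<alpha> by (intro mult_right_mono powr_mono2) auto
      also have "\<dots> = 1" using t by (simp flip: powr_add)
      finally show ?thesis using 1 by (intro exI[of _ "r powr ?n"]) auto
    next
      case False
      let ?A = "A \<inter> ball x0 (2 * r)"
      have "N \<subseteq> (\<Union>a\<in>?A. ball a t)"
      proof
        fix x assume "x \<in> N"
        then have x: "dist x0 x < r" "infdist x A < t" by (auto simp: N_def)
        obtain a where a: "a \<in> A" "infdist x A = dist x a"
          using infdist_attains_inf[OF finite_imp_closed[OF A(1)] A(2)] by blast
        then have "dist x0 a < 2 * r" using x False dist_triangle[of x0 a x] by linarith
        then show "x \<in> (\<Union>a\<in>?A. ball a t)" using a x by (auto simp: dist_commute)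
      qed
      then have "emeasure lborel N \<le> emeasure lborel (\<Union>a\<in>?A. ball a t)"
        by (intro emeasure_mono) (auto intro!: borel_open)
      also have "\<dots> \<le> (\<Sum>a\<in>?A. emeasure lborel (ball a t))"
        using A(1) by (intro emeasure_subadditive_finite) auto
      also have "\<dots> = ennreal (V * (t powr ?n * real (card ?A)))"
        using V by (simp add: ball[OF t] ennreal_of_nat_eq_real_of_nat mult_ac flip: ennreal_mult)
      finally have 1: "emeasure lborel N \<le> ennreal (V * (t powr ?n * real (card ?A)))" .
      have "r powr (2 * \<alpha> - real ?n) * t powr (- 2 * \<alpha>) * (t powr ?n * real (card ?A))
        = r powr (2 * \<alpha> - real ?n) * (t powr (- 2 * \<alpha>) * t powr ?n) * real (card ?A)"
        by (simp only: mult_ac)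
      also have "t powr (- 2 * \<alpha>) * t powr ?n = t powr (real ?n - 2 * \<alpha>)"
        by (simp flip: powr_add)
      also have "r powr (2 * \<alpha> - real ?n) * t powr (real ?n - 2 * \<alpha>) * real (card ?A) \<le> max 1 b"
        using b[of r x0] False by simp
      finally show ?thesis using 1 by (intro exI[of _ "t powr ?n * real (card ?A)"]) auto
    qed
    then obtain m where m: "0 \<le> m" "emeasure lborel N \<le> ennreal (V * m)"
      "r powr (2 * \<alpha> - real ?n) * t powr (- 2 * \<alpha>) * m \<le> max 1 b" by blast
    let ?E = "\<integral>\<^sup>+x\<in>ball x0 r. (\<integral>\<^sup>+y\<in>ball x0 r.
        ennreal (\<bar>tent A t x - tent A t y\<bar>\<^sup>2 / norm (x - y) powr (real CARD('n) + 2 * \<alpha>))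
      \<partial>lebesgue) \<partial>lebesgue"
    have "?E \<le> 2 * ennreal (C0 * t powr (- 2 * \<alpha>)) * emeasure lborel N"
      unfolding N_def by (rule tent_energy_le[OF t I[OF t]]) simp
    also have "\<dots> \<le> 2 * ennreal (C0 * t powr (- 2 * \<alpha>)) * ennreal (V * m)"
      by (rule mult_left_mono[OF m(2)]) simp
    also have "\<dots> = ennreal (2 * (C0 * t powr (- 2 * \<alpha>)) * (V * m))"
      using C0 V m(1) by (simp add: ennreal_mult)
    finally have "ennreal (r powr (2 * \<alpha> - real ?n)) * ?E
      \<le> ennreal (r powr (2 * \<alpha> - real ?n)) * ennreal (2 * (C0 * t powr (- 2 * \<alpha>)) * (V * m))"
      by (rule mult_left_mono) simp
    also have "\<dots> = ennreal (C * (r powr (2 * \<alpha> - real ?n) * t powr (- 2 * \<alpha>) * m))"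
      using C0 V m(1) by (subst ennreal_mult[symmetric]) (auto simp: C_def mult_ac)
    also have "\<dots> \<le> ennreal (C * max 1 b)"
      using m(3) C by (intro ennreal_leI mult_left_mono) auto
    finally have "sqrt_ennreal (ennreal (r powr (2 * \<alpha> - real ?n)) * ?E) \<le> sqrt_ennreal (ennreal (C * max 1 b))"
      by (rule sqrt_ennreal_mono)
    then show "sqrt_ennreal (ennreal (r powr (2 * \<alpha> - real ?n)) * ?E) \<le> ennreal (sqrt (C * max 1 b))"
      using C by (subst (asm) sqrt_ennreal_ennreal) auto
  qed
  then show ?thesis using C by blast
qed

lemma L2_loc_tent: "0 < t \<Longrightarrow> L2_loc (tent A t :: real^'n::finite \<Rightarrow> real)"
  unfolding L2_loc_def locally_integrable_def set_integrable_def
proof (intro conjI allI impI)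
  assume t: "0 < t"
  show "tent A t \<in> borel_measurable lebesgue"
    by (intro measurable_completion) (simp add: borel_measurable_continuous_onI continuous_on_tent t)
  fix K :: "(real^'n) set" assume K: "compact K"
  have "integrable lborel (\<lambda>x. indicator K x *\<^sub>R (tent A t x)\<^sup>2)"
    by (rule borel_integrable_compact[OF K]) (intro continuous_intros continuous_on_tent t)
  then show "integrable lebesgue (\<lambda>x. indicator K x *\<^sub>R (tent A t x)\<^sup>2)"
    by (subst integrable_completion) auto
qed

section \<open>Centers of the cubes of a Cantor set\<close>

lemma sum_power_le:
  fixes c :: nat
  assumes "2 \<le> c"
  shows "(\<Sum>i\<le>k. c ^ i) \<le> 2 * c ^ k"
proof (induction k)
  case (Suc k)
  have "2 * c ^ k \<le> c * c ^ k" using assms by (rule mult_right_mono) simp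
  then show ?case unfolding sum.atMost_Suc power_Suc using Suc by linarith
qed simp

text \<open>After the common prefix, tails of every length up to \<open>m - k\<close> occur, because
  words shorter than \<open>m\<close> survive truncation unchanged. The geometric sum over the
  lengths costs the factor 2.\<close>

lemma card_take_image_le:
  fixes W :: "'a::finite list set"
  assumes "2 \<le> CARD('a)" and common: "\<And>v w. v \<in> W \<Longrightarrow> w \<in> W \<Longrightarrow> take k v = take k w"
  shows "finite (take m ` W) \<and> card (take m ` W) \<le> 2 * CARD('a) ^ (m - k)"
proof (cases "W = {}")
  case False
  then obtain v where v: "v \<in> W" by blast
  define p where "p = take k v"
  let ?U = "{u :: 'a list. set u \<subseteq> UNIV \<and> length u \<le> m - k}"
  have U: "finite ?U" by (rule finite_lists_length_le) simp
  \<comment> \<open>Truncating \<open>p @ u\<close> once more also covers \<open>m \<le> k\<close>,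
    where the prefix alone is already long enough and \<open>m - k = 0\<close>.\<close>
  have sub: "take m ` W \<subseteq> (\<lambda>u. take m (p @ u)) ` ?U"
  proof
    fix x assume "x \<in> take m ` W"
    then obtain w where w: "w \<in> W" "x = take m w" by blast
    have p: "p = take k w" using common[OF v w(1)] by (simp add: p_def)
    have "take m (p @ take (m - k) (drop k w)) = take m w"
    proof (cases "k \<le> length w")
      case True
      then show ?thesis
        using take_add[of k "m - k" w] by (cases "m \<le> k") (auto simp: p min_def)
    qed (simp add: p)
    then show "x \<in> (\<lambda>u. take m (p @ u)) ` ?U"
      using w(2) by (intro image_eqI[of _ _ "take (m - k) (drop k w)"]) auto
  qed
  have "card (take m ` W) \<le> card ((\<lambda>u. take m (p @ u)) ` ?U)"
    using U sub by (intro card_mono) auto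
  also have "\<dots> \<le> card ?U" using U by (rule card_image_le)
  also have "card ?U = (\<Sum>i\<le>m - k. CARD('a) ^ i)"
    by (rule card_lists_length_le) simp
  also have "\<dots> \<le> 2 * CARD('a) ^ (m - k)" by (rule sum_power_le[OF assms(1)])
  finally show ?thesis using finite_subset[OF sub] U by simp
qed simp

lemma emeasure_cube:
  assumes "0 \<le> r"
  shows "emeasure lborel (cube (a::real^'n) r) = ennreal (r ^ CARD('n))"
proof -
  have "emeasure lborel (cube a r) = ennreal (\<Prod>b\<in>Basis. ((\<chi> i. a $ i + r) - a) \<bullet> b)"
    unfolding cube_def by (rule emeasure_lborel_cbox) (use assms in \<open>auto simp: Basis_vec_def inner_axis\<close>)
  also have "(\<Prod>b\<in>Basis. ((\<chi> i. a $ i + r) - a) \<bullet> b) = (\<Prod>b\<in>(Basis::(real^'n) set). r)"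
    by (rule prod.cong) (auto simp: Basis_vec_def inner_axis)
  finally show ?thesis by simp
qed

text \<open>The argument \<open>ty\<close> only fixes the dimension.\<close>
locale cantor =
  fixes l d :: real and ty :: "'n::finite itself"
  assumes l_pos: "0 < l" and l_less: "l < 1/2" and d_pos: "0 < d"
    and l_powr_d: "l powr (- d) = 2 ^ CARD('n)"
begin

text \<open>Chosen so that the initial cube lies in the ball of radius 1/2, even in the sum norm,
  which leaves room in the unit ball for the stretched balls.\<close>

definition half_width :: real where "half_width = 1 / (2 * real CARD('n))"

text \<open>Half the width of the central hole of the initial cube: the inner faces of its subcubes
  lie at \<open>(1 - l) * half_width - l * half_width\<close>.\<close>

definition gap :: real where "gap = (1 - 2 * l) * half_width"

text \<open>The center of the cube with address \<open>w\<close>. A letter chooses a sign in each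
  coordinate, that is, a corner; the first letter is the coarsest, so a common prefix means a common
  cube.\<close>

primrec pos :: "('n \<Rightarrow> bool) list \<Rightarrow> real^'n" where
  "pos [] = 0"
| "pos (a # w) = ((1 - l) * half_width) *\<^sub>R (\<chi> i. if a i then 1 else - 1) + l *\<^sub>R pos w"

lemma half_width: "0 < half_width" "half_width \<le> 1/2"
  using zero_less_card_finite[where 'a = 'n] by (auto simp: half_width_def divide_simps)

lemma gap: "0 < gap" "gap \<le> 1/2"
proof -
  show "0 < gap" unfolding gap_def using half_width l_less by (intro mult_pos_pos) auto
  have "(1 - 2 * l) * half_width \<le> 1 * (1/2)"
    using half_width l_pos l_less by (intro mult_mono) auto
  then show "gap \<le> 1/2" by (simp add: gap_def)
qed

lemma abs_pos_le: "\<bar>pos w $ i\<bar> \<le> half_width"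
proof (induction w)
  case Nil
  then show ?case using half_width by simp
next
  case (Cons a w)
  have "\<bar>pos (a # w) $ i\<bar> \<le> (1 - l) * half_width + l * \<bar>pos w $ i\<bar>"
    using l_pos l_less half_width by (auto simp: abs_mult intro!: order_trans[OF abs_triangle_ineq] order_trans[OF abs_triangle_ineq4])
  also have "\<dots> \<le> (1 - l) * half_width + l * half_width"
    using Cons l_pos by simp
  finally show ?case by (simp add: algebra_simps)
qed

lemma norm_pos_le: "norm (pos w) \<le> 1/2"
proof -
  have "norm (pos w) \<le> (\<Sum>i\<in>UNIV. \<bar>pos w $ i\<bar>)" by (rule norm_le_l1_cart)
  also have "\<dots> \<le> real CARD('n) * half_width"
    using sum_bounded_above[of UNIV "\<lambda>i. \<bar>pos w $ i\<bar>", OF abs_pos_le] by simp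
  finally show ?thesis by (simp add: half_width_def)
qed

lemma pos_append: "pos (v @ w) = pos v + l ^ length v *\<^sub>R pos w"
  by (induction v) (auto simp: algebra_simps)

lemma pos_take: "\<bar>pos w $ i - pos (take m w) $ i\<bar> \<le> l ^ m * half_width"
proof (cases "m \<le> length w")
  case True
  have "pos w = pos (take m w) + l ^ m *\<^sub>R pos (drop m w)"
    using pos_append[of "take m w" "drop m w"] True by (simp add: min_def)
  then have "pos w $ i - pos (take m w) $ i = l ^ m * pos (drop m w) $ i" by simp
  then show ?thesis using abs_pos_le[of "drop m w" i] l_pos by (simp add: abs_mult)
qed (use half_width l_pos in simp)

lemma dist_pos_Nil_Cons: "gap \<le> dist (pos []) (pos (a # w))"
proof -
  \<comment> \<open>Any coordinate works: the subcubes avoid the central slab in every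
    direction.\<close>
  obtain i :: 'n where True by simp
  have "gap \<le> (1 - l) * half_width - l * \<bar>pos w $ i\<bar>"
    using mult_left_mono[OF abs_pos_le[of w i], of l] l_pos by (simp add: gap_def algebra_simps)
  also have "\<dots> = \<bar>(1 - l) * half_width * (if a i then 1 else - 1)\<bar> - \<bar>l * pos w $ i\<bar>"
    using l_pos l_less half_width by (simp add: abs_mult)
  also have "\<dots> \<le> \<bar>pos (a # w) $ i\<bar>"
    by simp
  also have "\<dots> \<le> dist (pos []) (pos (a # w))"
    using component_le_norm_cart[of "pos (a # w)" i] by (simp add: dist_norm del: pos.simps(2))
  finally show ?thesis .
qed

text \<open>In a coordinate where the letters differ, the subcubes are even \<open>2 * gap\<close>
  apart; the weaker bound is the one shared with the distance from a center to its subcubes.\<close>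

lemma dist_pos_Cons_Cons:
  assumes "a \<noteq> b"
  shows "gap \<le> dist (pos (a # v)) (pos (b # w))"
proof -
  obtain i where i: "a i \<noteq> b i" using assms by blast
  let ?s = "\<lambda>c. if c i then 1 else - 1 :: real"
  have s: "\<bar>?s a - ?s b\<bar> = 2" using i by auto
  have e: "(pos (a # v) - pos (b # w)) $ i = (1 - l) * half_width * (?s a - ?s b) + l * (pos v $ i - pos w $ i)"
    by (simp add: algebra_simps)
  have "l * \<bar>pos v $ i - pos w $ i\<bar> \<le> l * (2 * half_width)"
    using abs_pos_le[of v i] abs_pos_le[of w i] l_pos by (intro mult_left_mono) auto
  then have x: "\<bar>l * (pos v $ i - pos w $ i)\<bar> \<le> l * (2 * half_width)"
    using l_pos by (simp add: abs_mult)
  have y: "\<bar>(1 - l) * half_width * (?s a - ?s b)\<bar> = (1 - l) * half_width * 2"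
    using s l_less half_width by (simp add: abs_mult)
  have "gap \<le> 2 * gap" using gap by simp
  also have "2 * gap = (1 - l) * half_width * 2 - l * (2 * half_width)" by (simp add: gap_def algebra_simps)
  also have "\<dots> \<le> \<bar>(1 - l) * half_width * (?s a - ?s b)\<bar> - \<bar>l * (pos v $ i - pos w $ i)\<bar>"
    using x unfolding y by simp
  also have "\<dots> \<le> \<bar>(pos (a # v) - pos (b # w)) $ i\<bar>" unfolding e by linarith
  also have "\<dots> \<le> dist (pos (a # v)) (pos (b # w))"
    unfolding dist_norm by (rule component_le_norm_cart)
  finally show ?thesis .
qed

lemma dist_pos_less_gap:
  assumes "dist (pos v) (pos w) < gap"
  shows "v = [] \<and> w = [] \<or> (\<exists>a v' w'. v = a # v' \<and> w = a # w')"
proof (cases v)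
  case Nil
  then show ?thesis using assms dist_pos_Nil_Cons by (cases w) (auto simp: not_less[symmetric] simp del: pos.simps)
next
  case (Cons a v')
  then show ?thesis
    using assms dist_pos_Nil_Cons dist_pos_Cons_Cons
    by (cases w) (metis dist_commute not_less)+
qed

text \<open>A common first letter can be removed, which divides the distance by \<open>l\<close>.
  The length is \<open>Suc k\<close> because distance below \<open>gap\<close> already decides the
  first letter, or that both words are empty.\<close>

lemma take_eq_if_dist_less:
  "dist (pos v) (pos w) < gap * l ^ k \<Longrightarrow> take (Suc k) v = take (Suc k) w"
proof (induction k arbitrary: v w)
  case 0
  then show ?case using dist_pos_less_gap[of v w] by auto
next
  case (Suc k)
  have "l ^ Suc k \<le> 1" using l_pos l_less by (intro power_le_one) auto
  then have "gap * l ^ Suc k \<le> gap * 1" using gap by (intro mult_left_mono) auto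
  then have "dist (pos v) (pos w) < gap" using Suc.prems by linarith
  then consider "v = []" "w = []" | a v' w' where "v = a # v'" "w = a # w'"
    using dist_pos_less_gap by blast
  then show ?case
  proof cases
    case 2
    then have "dist (pos v) (pos w) = l * dist (pos v') (pos w')"
      using l_pos by (simp add: dist_norm flip: scaleR_diff_right)
    then have "l * dist (pos v') (pos w') < l * (gap * l ^ k)" using Suc.prems by (simp add: mult_ac)
    then have "dist (pos v') (pos w') < gap * l ^ k" using l_pos by simp
    then show ?thesis using Suc.IH 2 by simp
  qed simp
qed

text \<open>Half the hole is left to the balls around the other centers.\<close>

definition rad :: "('n \<Rightarrow> bool) list \<Rightarrow> real" where "rad w = gap / 2 * l ^ length w"

lemma rad_pos: "0 < rad w" using gap l_pos by (simp add: rad_def)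

text \<open>For the shorter word \<open>v\<close> the radii add up to at most
  \<open>gap * l ^ length v\<close>. A smaller distance would make the words agree up to one letter
  beyond the end of \<open>v\<close>, so \<open>w\<close> could not properly extend
  \<open>v\<close>.\<close>

lemma dist_pos_ge:
  assumes "v \<noteq> w"
  shows "rad v + rad w \<le> dist (pos v) (pos w)"
proof -
  have *: "rad v + rad w \<le> dist (pos v) (pos w)" if vw: "v \<noteq> w" "length v \<le> length w" for v w
  proof (rule ccontr)
    assume less: "\<not> rad v + rad w \<le> dist (pos v) (pos w)"
    have "l ^ length w \<le> l ^ length v"
      using vw(2) l_pos l_less by (intro power_decreasing) auto
    then have "rad w \<le> rad v" using gap by (simp add: rad_def)
    then have "dist (pos v) (pos w) < gap * l ^ length v" using less by (simp add: rad_def)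
    then have eq: "take (Suc (length v)) v = take (Suc (length v)) w" by (rule take_eq_if_dist_less)
    then have "v = take (Suc (length v)) w" by simp
    then have "length v = length (take (Suc (length v)) w)" by (rule arg_cong)
    then have "length v = min (length w) (Suc (length v))" by (simp only: length_take)
    then have "length w = length v" using vw(2) by linarith
    then show False using eq vw(1) by simp
  qed
  show ?thesis using *[of v w] *[of w v] assms by (cases "length v \<le> length w") (auto simp: dist_commute add.commute)
qed

sublocale ball_family pos rad
proof
  show "ball (pos v) (rad v) \<inter> ball (pos w) (rad w) = {}" if "v \<noteq> w" for v w
  proof -
    have False if "dist (pos v) z < rad v" "dist (pos w) z < rad w" for z
      using that dist_pos_ge[OF \<open>v \<noteq> w\<close>] dist_triangle[of "pos v" "pos w" z]
      by (simp add: dist_commute)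
    then show ?thesis by auto
  qed
qed (rule rad_pos)

section \<open>Counting and covering the centers\<close>

lemma finite_rad_ge:
  assumes "0 < \<delta>"
  shows "finite {w. \<delta> \<le> rad w}"
proof -
  obtain m where m: "l ^ m < \<delta>" using real_arch_pow_inv[OF assms, of l] l_less by auto
  have "{w. \<delta> \<le> rad w} \<subseteq> {w. set w \<subseteq> UNIV \<and> length w \<le> m}"
  proof (clarsimp, rule ccontr)
    fix w assume w: "\<delta> \<le> rad w" "\<not> length w \<le> m"
    have "rad w \<le> 1 * l ^ length w" unfolding rad_def
      using gap l_pos by (intro mult_right_mono) auto
    also have "\<dots> \<le> l ^ m" using w(2) l_pos l_less by (simp add: power_decreasing)
    finally show False using w(1) m by simp
  qed
  then show ?thesis by (rule finite_subset) (rule finite_lists_length_le, simp)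
qed

lemma card_digits: "CARD('n \<Rightarrow> bool) = 2 ^ CARD('n)"
  by (simp add: card_fun)

lemma card_digits_ge: "2 \<le> CARD('n \<Rightarrow> bool)"
  unfolding card_digits using power_increasing[of 1 "CARD('n)" "2::nat"] by (simp add: Suc_leI)

lemma card_digits_power: "real (CARD('n \<Rightarrow> bool) ^ m) = (1 / l ^ m) powr d"
proof -
  have "real (CARD('n \<Rightarrow> bool) ^ m) = (l powr (- d)) ^ m"
    unfolding card_digits l_powr_d by simp
  also have "\<dots> = (1 / l ^ m) powr d"
    using l_pos by (simp add: powr_minus powr_divide powr_powr power_one_over inverse_eq_divide mult.commute flip: powr_realpow)
  finally show ?thesis .
qed

lemma card_take_le: "card (take m ` (W :: ('n \<Rightarrow> bool) list set)) \<le> 2 * CARD('n \<Rightarrow> bool) ^ m"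
  using card_take_image_le[OF card_digits_ge, of W 0 m] by simp

text \<open>A ball of radius \<open>s\<close> only meets words with a common prefix of length \<open>k\<close>, where \<open>l ^ k\<close>
  is comparable to \<open>s\<close>.\<close>
lemma card_take_ball_le:
  assumes s: "0 < s"
  shows "finite (take m ` {w. pos w \<in> ball x s})"
    and "real (card (take m ` {w. pos w \<in> ball x s})) \<le> 2 * max 1 ((2 * s / gap / l ^ m) powr d)"
proof -
  let ?W = "{w. pos w \<in> ball x s}"
  obtain j where j: "l ^ j < 2 * s / gap"
    using real_arch_pow_inv[of "2 * s / gap" l] s gap l_less by auto
  \<comment> \<open>Minimality is used twice: the previous power is still at least
    \<open>2 * s / gap\<close>, which forces a common prefix of length \<open>k\<close>, while
    \<open>l ^ k\<close> itself is small enough to bound the number of continuations.\<close>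
  define k where "k = (LEAST k. l ^ k < 2 * s / gap)"
  have k: "l ^ k < 2 * s / gap" unfolding k_def using j by (rule LeastI)
  have common: "take k v = take k w" if "v \<in> ?W" "w \<in> ?W" for v w
  proof (cases k)
    case (Suc i)
    then have "\<not> l ^ i < 2 * s / gap"
      using not_less_Least[of i "\<lambda>k. l ^ k < 2 * s / gap"] by (simp add: k_def)
    then have "2 * s \<le> gap * l ^ i" using gap by (simp add: divide_simps mult.commute not_less)
    moreover have "dist (pos v) (pos w) < 2 * s"
      using that dist_triangle[of "pos v" "pos w" x] by (simp add: dist_commute)
    ultimately show ?thesis unfolding Suc by (intro take_eq_if_dist_less) simp
  qed simp
  have *: "finite (take m ` ?W) \<and> card (take m ` ?W) \<le> 2 * CARD('n \<Rightarrow> bool) ^ (m - k)"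
    by (rule card_take_image_le[OF card_digits_ge common])
  then show "finite (take m ` ?W)" by blast
  have "card (take m ` ?W) \<le> 2 * CARD('n \<Rightarrow> bool) ^ (m - k)" using * by blast
  then have "real (card (take m ` ?W)) \<le> real (2 * CARD('n \<Rightarrow> bool) ^ (m - k))"
    using of_nat_mono by blast
  also have "\<dots> = 2 * real (CARD('n \<Rightarrow> bool) ^ (m - k))"
    by (simp only: of_nat_mult of_nat_numeral)
  also have "real (CARD('n \<Rightarrow> bool) ^ (m - k)) \<le> max 1 ((2 * s / gap / l ^ m) powr d)"
  proof (cases "m \<le> k")
    case False
    have "1 / l ^ (m - k) = l ^ k / l ^ m"
      using False l_pos by (simp add: power_diff)
    also have "\<dots> \<le> 2 * s / gap / l ^ m" using k l_pos by (intro divide_right_mono) auto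
    finally have "(1 / l ^ (m - k)) powr d \<le> (2 * s / gap / l ^ m) powr d"
      using l_pos d_pos by (intro powr_mono2) auto
    then show ?thesis unfolding card_digits_power by simp
  qed simp
  finally show "real (card (take m ` ?W)) \<le> 2 * max 1 ((2 * s / gap / l ^ m) powr d)" by simp
qed

definition generation :: "nat \<Rightarrow> (real^'n) set" where
  "generation m = pos ` {w. length w = m}"

lemma finite_words: "finite {w :: ('n \<Rightarrow> bool) list. length w = m}"
  using finite_lists_length_eq[of "UNIV :: ('n \<Rightarrow> bool) set" m] by simp

lemma card_words: "card {w :: ('n \<Rightarrow> bool) list. length w = m} = CARD('n \<Rightarrow> bool) ^ m"
  using card_lists_length_eq[of "UNIV :: ('n \<Rightarrow> bool) set" m] by simp

lemma finite_generation: "finite (generation m)"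
  unfolding generation_def using finite_words by blast

lemma generation_nonempty: "generation m \<noteq> {}"
  unfolding generation_def using Ex_list_of_length[of m] by auto

text \<open>A word of length \<open>m\<close> is its own truncation. The second bound counts all
  words and serves large balls.\<close>

lemma card_generation_ball_le:
  assumes "0 < s"
  shows "real (card (generation m \<inter> ball x s)) \<le> 2 * max 1 ((2 * s / gap / l ^ m) powr d)"
    and "real (card (generation m \<inter> ball x s)) \<le> 2 * (1 / l ^ m) powr d"
proof -
  let ?T = "take m ` {w. pos w \<in> ball x s}"
  have "generation m \<inter> ball x s \<subseteq> pos ` ?T"
  proof
    fix y assume "y \<in> generation m \<inter> ball x s"
    then obtain w where w: "length w = m" "y = pos w" "pos w \<in> ball x s"
      by (auto simp: generation_def)
    then have "w \<in> ?T" by (intro image_eqI[of _ _ w]) auto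
    then show "y \<in> pos ` ?T" using w(2) by blast
  qed
  then have "card (generation m \<inter> ball x s) \<le> card (pos ` ?T)"
    using card_take_ball_le(1)[OF assms] by (intro card_mono) auto
  also have "\<dots> \<le> card ?T" using card_take_ball_le(1)[OF assms] by (rule card_image_le)
  finally have *: "real (card (generation m \<inter> ball x s)) \<le> real (card ?T)" by simp
  then show "real (card (generation m \<inter> ball x s)) \<le> 2 * max 1 ((2 * s / gap / l ^ m) powr d)"
    using card_take_ball_le(2)[OF assms, of m x] by linarith
  have "real (card ?T) \<le> real (2 * CARD('n \<Rightarrow> bool) ^ m)"
    by (rule of_nat_mono[OF card_take_le])
  then have "real (card ?T) \<le> 2 * real (CARD('n \<Rightarrow> bool) ^ m)"
    by (simp only: of_nat_mult of_nat_numeral)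
  then show "real (card (generation m \<inter> ball x s)) \<le> 2 * (1 / l ^ m) powr d"
    using * unfolding card_digits_power by linarith
qed

lemma pos_in_cube:
  assumes "2 * half_width * l ^ m \<le> r"
  shows "pos w \<in> cube (\<chi> i. pos (take m w) $ i - l ^ m * half_width) r"
  unfolding cube_def mem_box_cart
proof (intro allI conjI)
  fix i
  show "(\<chi> i. pos (take m w) $ i - l ^ m * half_width) $ i \<le> pos w $ i"
    using pos_take[of w i m] by simp
  show "pos w $ i \<le> (\<chi> i. (\<chi> i. pos (take m w) $ i - l ^ m * half_width) $ i + r) $ i"
    using pos_take[of w i m] assms by (simp add: abs_le_iff algebra_simps)
qed

text \<open>All centers below a prefix lie in its cube, shorter words included, and finitely many
  closed cubes also contain the limit points.\<close>

lemma closure_pos_subset: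
  assumes "2 * half_width * l ^ m \<le> r" "finite (take m ` W)"
  shows "closure (pos ` W) \<subseteq> (\<Union>a\<in>(\<lambda>v. \<chi> i. pos v $ i - l ^ m * half_width) ` take m ` W. cube a r)"
proof (rule closure_minimal)
  show "pos ` W \<subseteq> (\<Union>a\<in>(\<lambda>v. \<chi> i. pos v $ i - l ^ m * half_width) ` take m ` W. cube a r)"
    using pos_in_cube[OF assms(1)] by fastforce
  show "closed (\<Union>a\<in>(\<lambda>v. \<chi> i. pos v $ i - l ^ m * half_width) ` take m ` W. cube a r)"
    using assms(2) by (intro closed_UN) (auto simp: cube_def closed_cbox)
qed

text \<open>At level \<open>m\<close> there are at most \<open>2 * 2 ^ (n * m)\<close> cubes of
  volume \<open>l ^ (m * n)\<close>; since \<open>l < 1/2\<close> the total volume tends to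
  0.\<close>

lemma negligible_closure_pos: "negligible (closure (range pos))"
proof -
  let ?n = "CARD('n)"
  have bound: "emeasure lborel (closure (range pos)) \<le> ennreal (2 * (2 * l) ^ (m * ?n))" for m
  proof -
    let ?T = "take m ` (UNIV :: ('n \<Rightarrow> bool) list set)"
    let ?F = "(\<lambda>v. \<chi> i. pos v $ i - l ^ m * half_width) ` ?T"
    have fin: "finite ?T" using card_take_image_le[OF card_digits_ge, of UNIV 0 m] by simp
    have sub: "closure (range pos) \<subseteq> (\<Union>a\<in>?F. cube a (l ^ m))"
      using half_width l_pos by (intro closure_pos_subset fin) (auto simp: mult_left_le_one_le)
    have "emeasure lborel (closure (range pos)) \<le> emeasure lborel (\<Union>a\<in>?F. cube a (l ^ m))"
      using fin by (intro emeasure_mono sub) (auto simp: cube_def intro!: borel_closed closed_UN closed_cbox)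
    also have "\<dots> \<le> (\<Sum>a\<in>?F. emeasure lborel (cube a (l ^ m)))"
      using fin by (intro emeasure_subadditive_finite) (auto simp: cube_def)
    also have "\<dots> = ennreal (real (card ?F) * (l ^ m) ^ ?n)"
      using l_pos by (simp add: emeasure_cube ennreal_of_nat_eq_real_of_nat ennreal_mult)
    also have "\<dots> \<le> ennreal ((2 * real (CARD('n \<Rightarrow> bool) ^ m)) * (l ^ m) ^ ?n)"
    proof (intro ennreal_leI mult_right_mono)
      have "card ?F \<le> 2 * CARD('n \<Rightarrow> bool) ^ m"
        using card_image_le[OF fin] card_take_le[of m UNIV] by (rule order_trans)
      then have "real (card ?F) \<le> real (2 * CARD('n \<Rightarrow> bool) ^ m)" by (rule of_nat_mono)
      then show "real (card ?F) \<le> 2 * real (CARD('n \<Rightarrow> bool) ^ m)"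
        by (simp only: of_nat_mult of_nat_numeral)
    qed (use l_pos in simp)
    also have "(2 * real (CARD('n \<Rightarrow> bool) ^ m)) * (l ^ m) ^ ?n = 2 * (2 * l) ^ (m * ?n)"
      unfolding card_digits by (simp add: power_mult_distrib mult.commute flip: power_mult)
    finally show ?thesis .
  qed
  have "(\<lambda>m. (2 * l) ^ (m * ?n)) \<longlonglongrightarrow> 0"
  proof (rule tendsto_sandwich[OF _ _ tendsto_const LIMSEQ_realpow_zero[of "2 * l"]])
    show "\<forall>\<^sub>F m in sequentially. (2 * l) ^ (m * ?n) \<le> (2 * l) ^ m"
      using l_pos l_less by (intro always_eventually allI power_decreasing) (auto simp: Suc_leI)
  qed (use l_pos l_less in auto)
  then have "(\<lambda>m. ennreal (2 * (2 * l) ^ (m * ?n))) \<longlonglongrightarrow> ennreal (2 * 0)"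
    by (intro tendsto_ennrealI tendsto_mult_left)
  then have "emeasure lborel (closure (range pos)) \<le> ennreal (2 * 0)"
    by (rule LIMSEQ_le_const) (use bound in auto)
  then have "closure (range pos) \<in> null_sets lborel"
    by (simp add: null_sets_def)
  then show ?thesis
    by (simp add: negligible_iff_null_sets null_sets_completionI)
qed

lemma W11_loc_derivative_stretch: "W11_loc_derivative stretch stretch_deriv"
  by (rule W11_loc_derivative_lipschitz[OF stretch_lipschitz borel_measurable_stretch_deriv
      AE_has_derivative_stretch[OF finite_rad_ge negligible_closure_pos]])

end

section \<open>The dimension of the set of centers\<close>

lemma log_enat_mono: "a \<le> b \<Longrightarrow> log_enat a \<le> log_enat b"
  by (cases a; cases b) (auto simp: log_enat_def)

context cantor
begin

text \<open>The covering number is at most a constant times \<open>(R / r) powr d\<close>. In the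
  constant, the factor 2 accounts for short words, \<open>2 / gap\<close> for the prefix count in a
  ball, and \<open>1 / l\<close> for rounding \<open>r\<close> to a power of
  \<open>l\<close>.\<close>

lemma N_cov_closure_pos_le:
  assumes r: "0 < r" "r \<le> 1" "r \<le> R"
  shows "log_enat (N_cov r (closure (range pos) \<inter> ball x R))
    \<le> ereal (ln (2 * (2 / (gap * l)) powr d) + d * ln (R / r))"
proof -
  obtain j where j: "l ^ j < r" using real_arch_pow_inv[OF r(1), of l] l_less by auto
  \<comment> \<open>The first level whose cubes fit into cubes of edge \<open>r\<close>; by
    minimality \<open>l ^ m\<close> loses at most a factor \<open>l\<close>, where level 0 uses
    \<open>r \<le> 1\<close>.\<close>
  define m where "m = (LEAST m. l ^ m \<le> r)"
  have m: "l ^ m \<le> r" unfolding m_def by (rule LeastI[of _ j]) (use j in simp)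
  have lm: "l * r \<le> l ^ m"
  proof (cases m)
    case 0
    then show ?thesis using l_pos l_less r by (simp add: mult_le_one)
  next
    case (Suc i)
    then have "\<not> l ^ i \<le> r" using not_less_Least[of i "\<lambda>m. l ^ m \<le> r"] by (simp add: m_def)
    then show ?thesis using Suc l_pos by simp
  qed
  let ?W = "{w. pos w \<in> ball x R}"
  let ?T = "take m ` ?W"
  let ?F = "(\<lambda>v. \<chi> i. pos v $ i - l ^ m * half_width) ` ?T"
  have R: "0 < R" using r by simp
  have fin: "finite ?T" by (rule card_take_ball_le(1)[OF R])
  have "2 * half_width * l ^ m \<le> 1 * l ^ m"
    using half_width l_pos by (intro mult_right_mono) auto
  then have hw: "2 * half_width * l ^ m \<le> r" using m by simp
  \<comment> \<open>Since the ball is open, its points in the closure are limits of centers inside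
    the ball.\<close>
  have "closure (range pos) \<inter> ball x R \<subseteq> closure (pos ` ?W)"
  proof -
    have "ball x R \<inter> closure (range pos) \<subseteq> closure (ball x R \<inter> range pos)"
      by (rule open_Int_closure_subset) simp
    also have "ball x R \<inter> range pos = pos ` ?W" by auto
    finally show ?thesis by (simp add: Int_commute)
  qed
  also have "\<dots> \<subseteq> (\<Union>a\<in>?F. cube a r)" by (rule closure_pos_subset[OF hw fin])
  finally have "N_cov r (closure (range pos) \<inter> ball x R) \<le> enat (card ?F)"
    unfolding N_cov_def using fin by (intro INF_lower) auto
  also have "enat (card ?F) \<le> enat (card ?T)" using card_image_le[OF fin] by simp
  finally have N: "log_enat (N_cov r (closure (range pos) \<inter> ball x R)) \<le> log_enat (enat (card ?T))"
    by (rule log_enat_mono)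
  have gl: "0 < gap * l" "gap * l \<le> 1" using gap l_pos l_less by (auto intro: mult_le_one)
  have Rr: "1 \<le> R / r" using r by simp
  have "2 * R / gap / l ^ m \<le> 2 * R / gap / (l * r)"
    using gap R l_pos r lm by (intro divide_left_mono) auto
  also have "\<dots> = 2 / (gap * l) * (R / r)" by simp
  finally have "(2 * R / gap / l ^ m) powr d \<le> (2 / (gap * l) * (R / r)) powr d"
    using gap R l_pos d_pos by (intro powr_mono2) auto
  moreover have "1 \<le> 2 / (gap * l) * (R / r)"
    using mult_mono[of 1 "2 / (gap * l)" 1 "R / r"] gl Rr by simp
  then have "1 \<le> (2 / (gap * l) * (R / r)) powr d" using d_pos by (intro ge_one_powr_ge_zero) auto
  ultimately have "real (card ?T) \<le> 2 * (2 / (gap * l) * (R / r)) powr d"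
    using card_take_ball_le(2)[OF R, of m x] by linarith
  also have "\<dots> = (2 * (2 / (gap * l)) powr d) * (R / r) powr d"
    by (simp only: powr_mult mult.assoc)
  finally have c: "real (card ?T) \<le> (2 * (2 / (gap * l)) powr d) * (R / r) powr d" .
  have "log_enat (enat (card ?T)) \<le> ereal (ln ((2 * (2 / (gap * l)) powr d) * (R / r) powr d))"
  proof (cases "card ?T = 0")
    case False
    then have "0 < real (card ?T)" by simp
    then have "ln (real (card ?T)) \<le> ln ((2 * (2 / (gap * l)) powr d) * (R / r) powr d)"
      using c by (intro ln_mono)
    then show ?thesis using False by (simp add: log_enat_def)
  qed (simp add: log_enat_def)
  also have "ln ((2 * (2 / (gap * l)) powr d) * (R / r) powr d)
    = ln (2 * (2 / (gap * l)) powr d) + d * ln (R / r)"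
    using gl R r by (subst ln_mult_pos) (auto simp: ln_powr)
  finally show ?thesis using N by (rule order_trans[rotated])
qed

text \<open>A cube of edge \<open>r\<close> has diameter at most \<open>CARD('n) * r\<close>, too
  little to contain two centers of generation \<open>m\<close>.\<close>

lemma N_cov_closure_pos_ge:
  assumes r: "real CARD('n) * r < gap * l ^ m"
  shows "log_enat (N_cov r (closure (range pos) \<inter> ball 0 1)) \<ge> ereal (d * (real m * ln (1 / l)))"
proof -
  have "enat (CARD('n \<Rightarrow> bool) ^ m) \<le> N_cov r (closure (range pos) \<inter> ball 0 1)"
    unfolding N_cov_def
  proof (rule INF_greatest)
    fix B assume "B \<in> {A. finite A \<and> closure (range pos) \<inter> ball 0 1 \<subseteq> (\<Union>a\<in>A. cube a r)}"
    then have B: "finite B" "closure (range pos) \<inter> ball 0 1 \<subseteq> (\<Union>a\<in>B. cube a r)" by auto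
    let ?W = "{w :: ('n \<Rightarrow> bool) list. length w = m}"
    have "\<forall>w. \<exists>a\<in>B. pos w \<in> cube a r"
    proof
      fix w
      have "pos w \<in> closure (range pos) \<inter> ball 0 1"
        using norm_pos_le[of w] closure_subset[of "range pos"] by auto
      then show "\<exists>a\<in>B. pos w \<in> cube a r" using B(2) by blast
    qed
    then obtain b where b: "\<And>w. b w \<in> B" "\<And>w. pos w \<in> cube (b w) r" by metis
    have "inj_on b ?W"
    proof (rule inj_onI)
      fix v w assume vw: "v \<in> ?W" "w \<in> ?W" "b v = b w"
      have "\<bar>(pos v - pos w) $ i\<bar> \<le> r" for i
      proof -
        have "b v $ i \<le> pos v $ i \<and> pos v $ i \<le> b v $ i + r"
          "b v $ i \<le> pos w $ i \<and> pos w $ i \<le> b v $ i + r"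
          using b(2)[of v] b(2)[of w] vw(3) by (simp_all add: cube_def mem_box_cart)
        then show ?thesis by auto
      qed
      then have "norm (pos v - pos w) \<le> real CARD('n) * r"
        using norm_le_l1_cart[of "pos v - pos w"]
          sum_bounded_above[of UNIV "\<lambda>i. \<bar>(pos v - pos w) $ i\<bar>" r] by simp
      then have "dist (pos v) (pos w) < gap * l ^ m" using r by (simp add: dist_norm)
      then have "take (Suc m) v = take (Suc m) w" by (rule take_eq_if_dist_less)
      then show "v = w" using vw by simp
    qed
    then have "card ?W \<le> card B" using b(1) B(1) by (intro card_inj_on_le[of b]) auto
    then show "enat (CARD('n \<Rightarrow> bool) ^ m) \<le> enat (card B)" unfolding card_words by simp
  qed
  then have "log_enat (enat (CARD('n \<Rightarrow> bool) ^ m)) \<le> log_enat (N_cov r (closure (range pos) \<inter> ball 0 1))"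
    by (rule log_enat_mono)
  moreover have "log_enat (enat (CARD('n \<Rightarrow> bool) ^ m)) = ereal (d * (real m * ln (1 / l)))"
  proof -
    have "CARD('n \<Rightarrow> bool) ^ m \<noteq> 0" using card_digits_ge by simp
    then have "log_enat (enat (CARD('n \<Rightarrow> bool) ^ m)) = ereal (ln (real (CARD('n \<Rightarrow> bool) ^ m)))"
      by (simp only: log_enat_def enat.case if_False)
    also have "\<dots> = ereal (d * (real m * ln (1 / l)))"
      unfolding card_digits_power using l_pos by (simp add: ln_powr ln_div ln_realpow)
    finally show ?thesis .
  qed
  ultimately show ?thesis by simp
qed

definition scale_dim :: "nat \<Rightarrow> real \<Rightarrow> ereal" where
  "scale_dim N r = (SUP (x, R) \<in> {(x, R). real N * r \<le> R \<and> R \<le> 1}.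
         log_enat (N_cov r (closure (range pos) \<inter> ball x R)) / ereal (ln (R / r)))"

text \<open>The additive constant is divided by \<open>ln (R / r)\<close>, which is at least
  \<open>ln N\<close>; the error is uniform in the ball and in \<open>r\<close>.\<close>

lemma scale_dim_le:
  assumes N: "2 \<le> N" and r: "0 < r"
  shows "scale_dim N r \<le> ereal (d + ln (2 * (2 / (gap * l)) powr d) / ln (real N))"
  unfolding scale_dim_def
proof (rule SUP_least, clarify)
  fix x :: "real^'n" and R assume R: "real N * r \<le> R" "R \<le> 1"
  let ?c = "ln (2 * (2 / (gap * l)) powr d)"
  have gl: "0 < gap * l" "gap * l \<le> 1" using gap l_pos l_less by (auto intro: mult_le_one)
  have "1 \<le> 2 / (gap * l)" using gl by simp
  then have "1 \<le> (2 / (gap * l)) powr d" using d_pos by (intro ge_one_powr_ge_zero) auto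
  then have c: "0 \<le> ?c" by simp
  have "2 * r \<le> real N * r" using N r by (intro mult_right_mono) auto
  then have rR: "r < R" using R r by linarith
  have lnN: "0 < ln (real N)" using N by simp
  have "real N \<le> R / r" using R r by (simp add: field_simps)
  then have L: "ln (real N) \<le> ln (R / r)" using N by (intro ln_mono) auto
  have "log_enat (N_cov r (closure (range pos) \<inter> ball x R)) / ereal (ln (R / r))
    \<le> ereal (?c + d * ln (R / r)) / ereal (ln (R / r))"
    using L lnN r rR R by (intro ereal_divide_right_mono N_cov_closure_pos_le) auto
  also have "\<dots> = ereal (d + ?c / ln (R / r))"
    using L lnN by (simp add: field_simps)
  also have "\<dots> \<le> ereal (d + ?c / ln (real N))"
    using L lnN c by (simp add: divide_left_mono)
  finally show "log_enat (N_cov r (closure (range pos) \<inter> ball x R)) / ereal (ln (R / r))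
    \<le> ereal (d + ?c / ln (real N))" .
qed

text \<open>It suffices to test the unit ball at the scales \<open>k * l ^ m\<close>, where the
  generation of length \<open>m\<close> gives a quotient that tends to \<open>d\<close>.\<close>

lemma Limsup_scale_dim_ge: "ereal d \<le> Limsup (at_right 0) (scale_dim N)"
  unfolding Limsup_def
proof (rule INF_greatest)
  fix P assume "P \<in> {P. eventually P (at_right (0::real))}"
  then have P: "eventually P (at_right (0::real))" by simp
  \<comment> \<open>The 2 makes the separation inequality for cubes of edge \<open>k * l ^ m\<close>
    strict.\<close>
  define k where "k = gap / (2 * real CARD('n))"
  have k: "0 < k" using gap by (simp add: k_def)
  define r where "r m = k * l ^ m" for m
  have r_pos: "0 < r m" for m using k l_pos by (simp add: r_def)
  have r0: "r \<longlonglongrightarrow> 0"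
    unfolding r_def[abs_def] using l_pos l_less by (intro tendsto_mult_right_zero LIMSEQ_realpow_zero) auto
  have "filterlim r (at_right 0) sequentially"
    unfolding filterlim_at using r0 r_pos by (auto intro!: always_eventually simp: less_imp_neq[symmetric])
  then have Pr: "\<forall>\<^sub>F m in sequentially. P (r m)" by (rule eventually_compose_filterlim[OF P])
  have "(\<lambda>m. real N * r m) \<longlonglongrightarrow> real N * 0" by (intro tendsto_mult_left r0)
  then have Nr: "\<forall>\<^sub>F m in sequentially. real N * r m < 1"
    by (rule order_tendstoD) simp
  have r1: "\<forall>\<^sub>F m in sequentially. r m < 1"
    using r0 by (rule order_tendstoD) simp
  define L c where "L = ln (1 / l)" and "c = ln (1 / k)"
  have L: "0 < L" using l_pos l_less by (simp add: L_def)
  have lnr: "ln (1 / r m) = c + real m * L" for m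
    using k l_pos by (simp add: r_def L_def c_def ln_div ln_mult_pos ln_realpow)
  have ev: "\<forall>\<^sub>F m in sequentially. ereal (d * (real m * L) / (c + real m * L)) \<le> (SUP r\<in>{r. P r}. scale_dim N r)"
    using Pr Nr r1
  proof eventually_elim
    case (elim m)
    have pos: "0 < ln (1 / r m)" using elim(3) r_pos[of m] by simp
    have "real CARD('n) * r m < gap * l ^ m"
      using gap l_pos by (simp add: r_def k_def)
    then have "ereal (d * (real m * L)) / ereal (ln (1 / r m))
      \<le> log_enat (N_cov (r m) (closure (range pos) \<inter> ball 0 1)) / ereal (ln (1 / r m))"
      using pos unfolding L_def by (intro ereal_divide_right_mono N_cov_closure_pos_ge) auto
    also have "\<dots> \<le> scale_dim N (r m)"
      unfolding scale_dim_def using elim(2) by (intro SUP_upper2[of "(0, 1)"]) auto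
    also have "\<dots> \<le> (SUP r\<in>{r. P r}. scale_dim N r)"
      using elim(1) by (intro SUP_upper) auto
    finally show ?case using pos by (simp add: lnr)
  qed
  have "(\<lambda>m. d * (real m * L) / (c + real m * L)) \<longlonglongrightarrow> d"
  proof -
    have "(\<lambda>m. d * L / (c * inverse (real m) + L)) \<longlonglongrightarrow> d * L / (c * 0 + L)"
      using L by (intro tendsto_intros lim_inverse_n) auto
    moreover have "\<forall>\<^sub>F m in sequentially. d * L / (c * inverse (real m) + L) = d * (real m * L) / (c + real m * L)"
      using eventually_gt_at_top[of 0]
    proof eventually_elim
      case (elim m)
      then have "c * inverse (real m) + L = (c + real m * L) / real m" by (simp add: field_simps)
      then show ?case by simp
    qed
    ultimately show ?thesis using L by (simp add: filterlim_cong)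
  qed
  then have "(\<lambda>m. ereal (d * (real m * L) / (c + real m * L))) \<longlonglongrightarrow> ereal d"
    by (intro tendsto_intros)
  then show "ereal d \<le> Sup (scale_dim N ` {r. P r})"
    using ev by (intro tendsto_upperbound) auto
qed

text \<open>The lower bound holds for every \<open>N\<close>; in the upper bound the limit in
  \<open>N\<close> removes the constant factor of the covering numbers.\<close>

lemma minkowski_dim_L_closure_pos: "minkowski_dim_L (closure (range pos)) = ereal d"
proof -
  let ?F = "\<lambda>N. Limsup (at_right 0) (scale_dim N)"
  let ?b = "\<lambda>N. ereal (d + ln (2 * (2 / (gap * l)) powr d) / ln (real N))"
  have eq: "minkowski_dim_L (closure (range pos)) = liminf ?F"
    unfolding minkowski_dim_L_def scale_dim_def[abs_def] ..
  have "ereal d \<le> liminf ?F"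
    by (intro Liminf_bounded always_eventually allI Limsup_scale_dim_ge)
  moreover have "liminf ?F \<le> ereal d"
  proof -
    have "filterlim (\<lambda>N. ln (real N)) at_top sequentially"
      by (rule filterlim_compose[OF ln_at_top filterlim_real_sequentially])
    then have "(\<lambda>N. d + ln (2 * (2 / (gap * l)) powr d) / ln (real N)) \<longlonglongrightarrow> d + 0"
      by (intro tendsto_add tendsto_const tendsto_divide_0[OF tendsto_const] filterlim_at_top_imp_at_infinity)
    then have "?b \<longlonglongrightarrow> ereal d" by simp
    then have "liminf ?b = ereal d" by (intro lim_imp_Liminf) auto
    moreover have "liminf ?F \<le> liminf ?b"
    proof (rule Liminf_mono)
      have "?F N \<le> ?b N" if "2 \<le> N" for N
      proof (rule Limsup_bounded)
        show "\<forall>\<^sub>F r in at_right 0. scale_dim N r \<le> ?b N"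
          using eventually_at_right_less[of 0] by eventually_elim (rule scale_dim_le[OF that])
      qed
      then show "\<forall>\<^sub>F N in sequentially. ?F N \<le> ?b N"
        unfolding eventually_sequentially by blast
    qed
    ultimately show ?thesis by simp
  qed
  ultimately show ?thesis using eq by simp
qed

end

section \<open>Unboundedness of the composition operator\<close>

context cantor
begin

text \<open>Near the center of a ball of generation \<open>m\<close> the composition exceeds \<open>1/2\<close> on a ball of
  radius \<open>s / 2\<close>, where \<open>s\<close> is the geometric mean of \<open>t\<close> and the radius of that ball, and it
  vanishes at distance between \<open>s\<close> and \<open>2 * s\<close> from the center.\<close>
lemma tent_stretch_energy_ge:
  fixes t \<alpha> :: real and m :: nat
  defines "\<rho> \<equiv> gap / 2 * l ^ m"
  defines "s \<equiv> sqrt (\<rho> * t)"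
  defines "V \<equiv> unit_ball_vol (real CARD('n))"
  assumes t: "0 < t" "4 * t \<le> \<rho>" and \<alpha>: "0 \<le> \<alpha>"
  shows "ennreal ((1 / l ^ m) powr d * (1/4 * (4 * s) powr - (real CARD('n) + 2 * \<alpha>) * (V * (s / 2) ^ CARD('n))\<^sup>2))
    \<le> (\<integral>\<^sup>+x\<in>ball 0 1. (\<integral>\<^sup>+y\<in>ball 0 1.
        ennreal (\<bar>(tent (generation m) t \<circ> stretch) x - (tent (generation m) t \<circ> stretch) y\<bar>\<^sup>2
          / norm (x - y) powr (real CARD('n) + 2 * \<alpha>)) \<partial>lebesgue) \<partial>lebesgue)"
proof -
  let ?n = "CARD('n)"
  define p where "p = real ?n + 2 * \<alpha>"
  have p: "0 < p" using \<alpha> by (simp add: p_def add_pos_nonneg)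
  define u where "u = tent (generation m) t \<circ> stretch"
  have \<rho>: "0 < \<rho>" "\<rho> \<le> 1/4"
  proof -
    show "0 < \<rho>" using gap l_pos by (simp add: \<rho>_def)
    have "\<rho> \<le> gap / 2 * 1" unfolding \<rho>_def
      using gap l_pos l_less by (intro mult_left_mono power_le_one) auto
    then show "\<rho> \<le> 1/4" using gap by simp
  qed
  have s: "0 < s" using \<rho> t by (simp add: s_def)
  have s2: "s * s = \<rho> * t" using \<rho> t by (simp add: s_def)
  \<comment> \<open>The hypothesis \<open>4 * t \<le> \<rho>\<close> serves to keep the ring between
    \<open>s\<close> and \<open>2 * s\<close> inside the stretched ball.\<close>
  have s\<rho>: "2 * s \<le> \<rho>"
  proof -
    have "(2 * s)\<^sup>2 = \<rho> * (4 * t)" using s2 by (simp add: power2_eq_square)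
    also have "\<dots> \<le> \<rho>\<^sup>2" using t \<rho> by (simp add: power2_eq_square)
    finally show ?thesis by (rule power2_le_imp_le) (use \<rho> in simp)
  qed
  have V: "0 < V" unfolding V_def by (rule unit_ball_vol_pos) simp
  have ball: "emeasure lborel (ball (x::real^'n) r) = ennreal (V * r ^ ?n)" if "0 < r" for r x
    using that by (simp add: emeasure_ball V_def)
  let ?W = "{w :: ('n \<Rightarrow> bool) list. length w = m}"
  have rad: "rad w = \<rho>" if "w \<in> ?W" for w using that by (simp add: rad_def \<rho>_def)
  have stretch_norm: "norm (stretch x - pos w) = norm (x - pos w) * norm (x - pos w) / \<rho>"
    if "w \<in> ?W" "norm (x - pos w) < \<rho>" for x w
  proof -
    have "x \<in> ball (pos w) (rad w)" unfolding in_ball_norm unfolding rad[OF that(1)] by (rule that(2))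
    from stretch_in[OF this] show ?thesis using \<rho> that(1) by (simp add: rad)
  qed
  \<comment> \<open>A point at distance \<open>s / 2\<close> is mapped to distance
    \<open>t / 4\<close>, below the \<open>t / 2\<close> that suffices.\<close>
  have near: "1/2 \<le> u x" if w: "w \<in> ?W" and x: "x \<in> ball (pos w) (s / 2)" for w x
  proof -
    have nx: "norm (x - pos w) < s / 2" using x by (simp add: dist_norm norm_minus_commute)
    then have "norm (x - pos w) * norm (x - pos w) \<le> (s / 2) * (s / 2)"
      using s by (intro mult_mono) auto
    also have "(s / 2) * (s / 2) = t / 4 * \<rho>" using s2 by simp
    finally have "norm (x - pos w) * norm (x - pos w) / \<rho> \<le> t / 4"
      using \<rho> by (simp add: pos_divide_le_eq)
    then have "norm (x - pos w) * norm (x - pos w) / \<rho> \<le> t / 2" using t by linarith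
    then have "dist (stretch x) (pos w) \<le> t / 2"
      unfolding dist_norm using stretch_norm[OF w, of x] nx s\<rho> s by simp
    moreover have "infdist (stretch x) (generation m) \<le> dist (stretch x) (pos w)"
      using w by (intro infdist_le) (auto simp: generation_def)
    ultimately have "infdist (stretch x) (generation m) / t \<le> 1 / 2"
      using t by (simp add: divide_simps)
    then show ?thesis unfolding u_def tent_def comp_def by linarith
  qed
  obtain e :: "real^'n" where e: "norm e = 1" using vector_choose_size[of 1] by auto
  \<comment> \<open>Midway in the ring, so that the ball of radius \<open>s / 2\<close> around
    \<open>z w\<close> fits into it.\<close>
  define z where "z w = pos w + (3/2 * s) *\<^sub>R e" for w
  have ring: "s < norm (y - pos w) \<and> norm (y - pos w) < 2 * s" if "y \<in> ball (z w) (s / 2)" for w y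
  proof -
    have d: "norm (y - z w) < s / 2" using that by (simp add: dist_norm norm_minus_commute)
    have "norm (z w - pos w) = 3/2 * s" using e s by (simp add: z_def)
    moreover have "norm (y - pos w) \<le> norm (y - z w) + norm (z w - pos w)"
      using norm_triangle_ineq[of "y - z w" "z w - pos w"] by simp
    moreover have "norm (z w - pos w) \<le> norm (y - z w) + norm (y - pos w)"
      using norm_triangle_ineq[of "z w - y" "y - pos w"] by (simp add: norm_minus_commute)
    ultimately show ?thesis using d by linarith
  qed
  have far: "u y = 0" if w: "w \<in> ?W" and y: "y \<in> ball (z w) (s / 2)" for w y
  proof -
    note r = ring[OF y]
    then have y\<rho>: "norm (y - pos w) < \<rho>" using s\<rho> by linarith
    then have yb: "y \<in> ball (pos w) (rad w)" unfolding in_ball_norm unfolding rad[OF w] .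
    have "t \<le> infdist (stretch y) (generation m)"
    proof -
      obtain a where a: "a \<in> generation m" "infdist (stretch y) (generation m) = dist (stretch y) a"
        using infdist_attains_inf[OF finite_imp_closed[OF finite_generation] generation_nonempty] by blast
      then obtain v where v: "v \<in> ?W" "a = pos v" unfolding generation_def by blast
      have "t \<le> dist (stretch y) (pos v)"
      proof (cases "v = w")
        case True
        have "s * s \<le> norm (y - pos w) * norm (y - pos w)" using r s by (intro mult_mono) auto
        then have "t \<le> norm (y - pos w) * norm (y - pos w) / \<rho>"
          unfolding s2 using \<rho> by (simp add: pos_le_divide_eq mult.commute)
        then show ?thesis using True stretch_norm[OF w y\<rho>] by (simp add: dist_norm)
      next
        \<comment> \<open>The image stays in the ball of \<open>w\<close>, which is disjoint from
          the ball of \<open>v\<close>; other centers are thus at least \<open>\<rho>\<close>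
          away.\<close>
        case False
        then have "stretch y \<notin> ball (pos v) (rad v)"
          using stretch_mem[OF yb] disjoint[of v w] by blast
        then have "\<rho> \<le> dist (stretch y) (pos v)"
          using rad[OF v(1)] by (simp add: dist_commute not_less)
        then show ?thesis using t by linarith
      qed
      then show ?thesis using a v by simp
    qed
    then show ?thesis using t by (simp add: u_def tent_eq_0)
  qed
  \<comment> \<open>The values differ by at least 1/2, and the points by at most
    \<open>4 * s\<close>.\<close>
  define K where "K = 1/4 * (4 * s) powr - p"
  have K: "0 \<le> K" by (simp add: K_def)
  have kernel: "K \<le> \<bar>u x - u y\<bar>\<^sup>2 / norm (x - y) powr p"
    if w: "w \<in> ?W" and x: "x \<in> ball (pos w) (s / 2)" and y: "y \<in> ball (z w) (s / 2)" for w x y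
  proof -
    have nx: "norm (x - pos w) < s / 2" using x by (simp add: dist_norm norm_minus_commute)
    have "norm (x - y) \<le> norm (x - pos w) + norm (y - pos w)"
      using norm_triangle_ineq4[of "x - pos w" "y - pos w"] by simp
    then have le: "norm (x - y) \<le> 4 * s" using nx ring[OF y] s by linarith
    have "x \<noteq> y" using nx ring[OF y] s by auto
    then have "(4 * s) powr - p \<le> norm (x - y) powr - p"
      using le p by (intro powr_mono2') auto
    moreover have "(1/2)\<^sup>2 \<le> \<bar>u x - u y\<bar>\<^sup>2"
      using near[OF w x] far[OF w y] by (intro power_mono) auto
    ultimately have "(1/2)\<^sup>2 * (4 * s) powr - p \<le> \<bar>u x - u y\<bar>\<^sup>2 * norm (x - y) powr - p"
      by (intro mult_mono) auto
    moreover have "(1/2)\<^sup>2 = (1/4::real)" by (simp add: power2_eq_square)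
    moreover have "a / norm (x - y) powr p = a * norm (x - y) powr - p" for a
      by (simp only: powr_minus divide_inverse)
    ultimately show ?thesis unfolding K_def by (simp only:)
  qed
  have sub: "ball (pos w) (s / 2) \<subseteq> ball 0 1" "ball (z w) (s / 2) \<subseteq> ball 0 1" for w
  proof -
    show "ball (pos w) (s / 2) \<subseteq> ball 0 1"
    proof
      fix x assume "x \<in> ball (pos w) (s / 2)"
      then have "norm (x - pos w) < s / 2" by (simp add: dist_norm norm_minus_commute)
      then show "x \<in> ball 0 1"
        using norm_pos_le[of w] norm_triangle_ineq[of "x - pos w" "pos w"] s\<rho> \<rho> s by simp
    qed
    show "ball (z w) (s / 2) \<subseteq> ball 0 1"
    proof
      fix y assume "y \<in> ball (z w) (s / 2)"
      from ring[OF this] show "y \<in> ball 0 1"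
        using norm_pos_le[of w] norm_triangle_ineq[of "y - pos w" "pos w"] s\<rho> \<rho> s by simp
    qed
  qed
  define b where "b = V * (s / 2) ^ ?n"
  have b: "0 \<le> b" using V s by (simp add: b_def)
  have s': "0 < s / 2" using s by simp
  \<comment> \<open>Only pairs within one stretched ball are counted: the outer variable in a
    component of \<open>U\<close>, the inner one in the ball around the corresponding
    \<open>z w\<close>.\<close>
  define U where "U = (\<Union>w\<in>?W. ball (pos w) (s / 2))"
  have inner: "ennreal (K * b) \<le> (\<integral>\<^sup>+y\<in>ball 0 1. ennreal (\<bar>u x - u y\<bar>\<^sup>2 / norm (x - y) powr p) \<partial>lborel)"
    if "x \<in> U" for x
  proof -
    obtain w where w: "w \<in> ?W" "x \<in> ball (pos w) (s / 2)"
      using \<open>x \<in> U\<close> unfolding U_def by blast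
    have "ennreal (K * b) = ennreal K * emeasure lborel (ball (z w) (s / 2))"
      using K b by (simp add: ball[OF s'] b_def ennreal_mult)
    also have "\<dots> = (\<integral>\<^sup>+y. ennreal K * indicator (ball (z w) (s / 2)) y \<partial>lborel)"
      by (rule nn_integral_cmult_indicator[symmetric]) simp
    also have "\<dots> \<le> (\<integral>\<^sup>+y\<in>ball 0 1. ennreal (\<bar>u x - u y\<bar>\<^sup>2 / norm (x - y) powr p) \<partial>lborel)"
    proof (rule nn_integral_mono)
      fix y
      show "ennreal K * indicator (ball (z w) (s / 2)) y
        \<le> ennreal (\<bar>u x - u y\<bar>\<^sup>2 / norm (x - y) powr p) * indicator (ball 0 1) y"
      proof (cases "y \<in> ball (z w) (s / 2)")
        case True
        then have "y \<in> ball 0 1" using sub(2) by blast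
        then show ?thesis using True ennreal_leI[OF kernel[OF w True]]
          by (simp del: mem_ball)
      qed (simp del: mem_ball)
    qed
    finally show ?thesis .
  qed
  have U: "emeasure lborel U = ennreal ((1 / l ^ m) powr d * b)"
  proof -
    have "disjoint_family_on (\<lambda>w. ball (pos w) (s / 2)) ?W"
      unfolding disjoint_family_on_def
    proof (intro ballI impI)
      fix v w assume vw: "v \<in> ?W" "w \<in> ?W" "v \<noteq> w"
      have "ball (pos v) (s / 2) \<subseteq> ball (pos v) (rad v)" "ball (pos w) (s / 2) \<subseteq> ball (pos w) (rad w)"
        using rad[OF vw(1)] rad[OF vw(2)] s\<rho> s by (auto intro!: subset_ball)
      then show "ball (pos v) (s / 2) \<inter> ball (pos w) (s / 2) = {}"
        using disjoint[OF vw(3)] by blast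
    qed
    then have "emeasure lborel U = (\<Sum>w\<in>?W. emeasure lborel (ball (pos w) (s / 2)))"
      unfolding U_def using finite_words by (intro sum_emeasure[symmetric]) auto
    also have "\<dots> = ennreal (real (card ?W) * b)"
      using b by (simp add: ball[OF s'] b_def[symmetric] ennreal_of_nat_eq_real_of_nat ennreal_mult)
    also have "real (card ?W) = (1 / l ^ m) powr d"
      unfolding card_words by (rule card_digits_power)
    finally show ?thesis .
  qed
  have Um: "U \<in> sets lborel" unfolding U_def by (auto intro!: borel_open)
  have "ennreal ((1 / l ^ m) powr d * (K * b\<^sup>2)) = ennreal (K * b) * emeasure lborel U"
    unfolding U using K b by (simp add: power2_eq_square mult_ac flip: ennreal_mult)
  also have "\<dots> = (\<integral>\<^sup>+x. ennreal (K * b) * indicator U x \<partial>lborel)"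
    by (rule nn_integral_cmult_indicator[symmetric, OF Um])
  also have "\<dots> \<le> (\<integral>\<^sup>+x\<in>ball 0 1. (\<integral>\<^sup>+y\<in>ball 0 1. ennreal (\<bar>u x - u y\<bar>\<^sup>2 / norm (x - y) powr p) \<partial>lborel) \<partial>lborel)"
  proof (rule nn_integral_mono)
    fix x
    show "ennreal (K * b) * indicator U x
      \<le> (\<integral>\<^sup>+y\<in>ball 0 1. ennreal (\<bar>u x - u y\<bar>\<^sup>2 / norm (x - y) powr p) \<partial>lborel) * indicator (ball 0 1) x"
    proof (cases "x \<in> U")
      case True
      then have "x \<in> ball 0 1" using sub(1) unfolding U_def by blast
      then show ?thesis using True inner[OF True] by (simp del: mem_ball)
    qed simp
  qed
  finally show ?thesis
    unfolding nn_integral_completion K_def b_def p_def u_def by (simp only: mult.assoc)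
qed

text \<open>The tents of all generations have norms below one bound \<open>B\<close>, since the
  count of centers is controlled uniformly over all balls. After composition the energy in the unit
  ball alone grows like \<open>y ^ m\<close> with \<open>1 < y\<close>.\<close>

lemma not_composition_bounded_on_Q:
  assumes \<alpha>: "0 < \<alpha>" "\<alpha> < 1" and q: "0 < real CARD('n) - 2 * \<alpha>" "real CARD('n) - 2 * \<alpha> < d"
  shows "\<not> composition_bounded_on_Q \<alpha> stretch"
proof
  let ?n = "CARD('n)"
  define q where "q = real ?n - 2 * \<alpha>"
  have q0: "0 < q" "q < d" using q by (auto simp: q_def)
  \<comment> \<open>Solves \<open>(1 / l ^ m) powr d * \<tau> m powr q = 1\<close>; as
    \<open>d / q > 1\<close>, also \<open>\<tau> m \<le> l ^ m\<close>.\<close>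
  define \<tau> where "\<tau> m = l powr (real m * d / q)" for m
  \<comment> \<open>The factor turns \<open>\<tau> m \<le> l ^ m\<close> into
    \<open>4 * t m \<le> gap / 2 * l ^ m\<close>, as the energy bound requires.\<close>
  define t where "t m = gap / 8 * \<tau> m" for m
  have \<tau>_pos: "0 < \<tau> m" for m using l_pos by (simp add: \<tau>_def)
  have t_pos: "0 < t m" for m using gap \<tau>_pos by (simp add: t_def)
  have t_le: "4 * t m \<le> gap / 2 * l ^ m" for m
  proof -
    have "real m * 1 \<le> real m * (d / q)" using q0 by (intro mult_left_mono) auto
    then have "\<tau> m \<le> l powr (real m)"
      unfolding \<tau>_def using l_pos l_less by (intro powr_mono') auto
    then show ?thesis using gap l_pos by (simp add: t_def powr_realpow)
  qed
  have \<tau>q: "\<tau> m powr q = (l ^ m) powr d" for m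
  proof -
    have "\<tau> m powr q = l powr (real m * d)" unfolding \<tau>_def powr_powr using q0 by simp
    also have "\<dots> = (l ^ m) powr d" using l_pos by (simp add: powr_powr flip: powr_realpow)
    finally show ?thesis .
  qed
  have inv: "(1 / l ^ m) powr d * (l ^ m) powr d = 1" for m
    using l_pos by (simp flip: powr_mult)
  have tq: "(1 / l ^ m) powr d * t m powr q \<le> 1" for m
  proof -
    have "t m powr q \<le> \<tau> m powr q"
      using gap \<tau>_pos[of m] q0 by (intro powr_mono2) (auto simp: t_def)
    then have "(1 / l ^ m) powr d * t m powr q \<le> (1 / l ^ m) powr d * (l ^ m) powr d"
      unfolding \<tau>q by (rule mult_left_mono) simp
    then show ?thesis by (simp only: inv)
  qed
  define b where "b = 2 * (4 / gap) powr d"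
  have b: "2 \<le> b"
    using gap d_pos ge_one_powr_ge_zero[of "4 / gap" d] by (simp add: b_def)
  \<comment> \<open>Three regimes: at most 2 centers; radius at most 1, where the count grows like
    \<open>r powr d\<close> and \<open>r powr (d - q) \<le> 1\<close>; radius above 1, where all
    centers are counted and \<open>r powr (- q) \<le> 1\<close>.\<close>
  have count: "r powr (2 * \<alpha> - real ?n) * t m powr (real ?n - 2 * \<alpha>)
        * real (card (generation m \<inter> ball x (2 * r))) \<le> b" if r: "t m \<le> r" for m x r
  proof -
    have r0: "0 < r" using r t_pos[of m] by linarith
    let ?c = "real (card (generation m \<inter> ball x (2 * r)))"
    let ?X = "(1 / l ^ m) powr d"
    have c1: "?c \<le> 2 * max 1 ((2 * (2 * r) / gap / l ^ m) powr d)" and c2: "?c \<le> 2 * ?X"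
      using card_generation_ball_le[of "2 * r" m x] r0 by auto
    have rq: "r powr (2 * \<alpha> - real ?n) = r powr (- q)" by (simp add: q_def)
    have "r powr (- q) * t m powr q * ?c \<le> b"
    proof (cases "(2 * (2 * r) / gap / l ^ m) powr d \<le> 1")
      case True
      then have "?c \<le> 2" using c1 by simp
      moreover have "r powr (- q) * t m powr q \<le> r powr (- q) * r powr q"
        using r t_pos[of m] q0 by (intro mult_left_mono powr_mono2) auto
      moreover have "r powr (- q) * r powr q = 1" using r0 by (simp flip: powr_add)
      ultimately have "r powr (- q) * t m powr q * ?c \<le> 1 * 2" by (intro mult_mono) auto
      then show ?thesis using b by simp
    next
      case False
      show ?thesis
      proof (cases "r \<le> 1")
        case True
        have "2 * (2 * r) / gap / l ^ m = 4 / gap * (r * (1 / l ^ m))" by simp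
        then have "(2 * (2 * r) / gap / l ^ m) powr d = (4 / gap) powr d * (r powr d * ?X)"
          by (simp only: powr_mult)
        then have "?c \<le> b * (r powr d * ?X)" using c1 False by (simp add: b_def)
        then have "r powr (- q) * t m powr q * ?c \<le> r powr (- q) * t m powr q * (b * (r powr d * ?X))"
          by (intro mult_left_mono) auto
        also have "\<dots> = b * ((r powr (- q) * r powr d) * (?X * t m powr q))" by (simp only: mult_ac)
        also have "\<dots> \<le> b * (1 * 1)"
        proof -
          have "r powr (- q) * r powr d = r powr (d - q)" by (simp flip: powr_add)
          also have "\<dots> \<le> 1" using True r0 q0 by (simp add: powr_le1)
          finally show ?thesis using tq[of m] b by (intro mult_left_mono mult_mono) auto
        qed
        finally show ?thesis by simp
      next
        case False
        have "r powr (- q) \<le> 1 powr (- q)" using False q0 by (intro powr_mono2') auto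
        then have rq1: "r powr (- q) \<le> 1" by simp
        have "r powr (- q) * t m powr q * ?c \<le> r powr (- q) * t m powr q * (2 * ?X)"
          by (rule mult_left_mono[OF c2]) simp
        also have "\<dots> = 2 * (r powr (- q) * (?X * t m powr q))" by (simp only: mult_ac)
        also have "\<dots> \<le> 2 * (1 * 1)" using rq1 tq[of m] by (intro mult_left_mono mult_mono) auto
        finally show ?thesis using b by simp
      qed
    qed
    then show ?thesis unfolding rq q_def .
  qed
  obtain CQ where CQ: "0 < CQ" and CQ_le: "\<And>(A::(real^'n) set) t b. finite A \<and> A \<noteq> {} \<and> 0 < t \<and>
      (\<forall>x r. t \<le> r \<longrightarrow> r powr (2 * \<alpha> - real ?n) * t powr (real ?n - 2 * \<alpha>)
        * real (card (A \<inter> ball x (2 * r))) \<le> b)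
      \<Longrightarrow> Q_norm \<alpha> (tent A t) \<le> ennreal (sqrt (CQ * max 1 b))"
    using Q_norm_tent_le[OF \<alpha>, where 'n = 'n] by blast
  define B where "B = sqrt (CQ * max 1 b)"
  have B: "0 \<le> B" using CQ b by (simp add: B_def)
  have upper: "Q_norm \<alpha> (tent (generation m) (t m)) \<le> ennreal B" for m
    unfolding B_def
    by (intro CQ_le conjI finite_generation generation_nonempty t_pos allI impI count)
  assume "composition_bounded_on_Q \<alpha> stretch"
  then obtain C where C: "\<And>u. u \<in> Q_space \<alpha> \<Longrightarrow> Q_norm \<alpha> (u \<circ> stretch) \<le> ennreal C * Q_norm \<alpha> u"
    unfolding composition_bounded_on_Q_def by blast
  \<comment> \<open>A negative \<open>C\<close> becomes 0 under \<open>ennreal\<close>.\<close>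
  define D where "D = max C 0 * B"
  have D: "0 \<le> D" using B by (simp add: D_def)
  have comp: "Q_norm \<alpha> (tent (generation m) (t m) \<circ> stretch) \<le> ennreal D" for m
  proof -
    have "tent (generation m) (t m) \<in> Q_space \<alpha>"
      unfolding Q_space_def using L2_loc_tent[OF t_pos] upper[of m]
      by (auto intro: le_less_trans)
    then have "Q_norm \<alpha> (tent (generation m) (t m) \<circ> stretch) \<le> ennreal C * Q_norm \<alpha> (tent (generation m) (t m))"
      by (rule C)
    also have "\<dots> \<le> ennreal (max C 0) * ennreal B"
      by (intro mult_mono upper ennreal_leI) auto
    also have "\<dots> = ennreal D" using B by (simp add: D_def ennreal_mult)
    finally show ?thesis .
  qed
  define V where "V = unit_ball_vol (real ?n)"
  have V: "0 < V" unfolding V_def by (rule unit_ball_vol_pos) simp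
  define c where "c = 1/4 * 4 powr - (real ?n + 2 * \<alpha>) * V\<^sup>2 * (1 / 2 ^ ?n)\<^sup>2 * (gap\<^sup>2 / 16) powr (q / 2)"
  have c: "0 < c" using V gap by (simp add: c_def)
  \<comment> \<open>The number of balls contributes the exponent \<open>- d\<close>, and
    \<open>s powr q\<close> contributes \<open>q / 2\<close> from the radius of the balls and
    \<open>d / 2\<close> from \<open>t m\<close>.\<close>
  define y where "y = l powr ((q - d) / 2)"
  have y: "1 < y"
    using q0 l_pos l_less powr_less_mono'[of l "(q - d) / 2" 0] by (simp add: y_def)
  have lower: "c * y ^ m \<le> D\<^sup>2" for m
  proof -
    define s where "s = sqrt (gap / 2 * l ^ m * t m)"
    have "0 < gap / 2 * l ^ m * t m" using gap l_pos t_pos[of m] by simp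
    then have s: "0 < s" by (simp add: s_def)
    have sq: "s powr q = (gap\<^sup>2 / 16) powr (q / 2) * (l powr (real m * q / 2) * l powr (real m * d / 2))"
    proof -
      have "s powr q = (gap / 2 * l ^ m * t m) powr (q / 2)"
        unfolding s_def using \<open>0 < gap / 2 * l ^ m * t m\<close>
        by (simp add: powr_powr mult.commute flip: powr_half_sqrt)
      also have "gap / 2 * l ^ m * t m = gap\<^sup>2 / 16 * (l powr real m * \<tau> m)"
        using l_pos by (simp add: t_def power2_eq_square powr_realpow)
      also have "\<dots> powr (q / 2) = (gap\<^sup>2 / 16) powr (q / 2) * ((l powr real m) powr (q / 2) * \<tau> m powr (q / 2))"
        by (simp only: powr_mult)
      also have "\<tau> m powr (q / 2) = l powr (real m * d / 2)"
        unfolding \<tau>_def powr_powr using q0 by simp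
      finally show ?thesis by (simp add: powr_powr)
    qed
    have Y: "(1 / l ^ m) powr d * (1/4 * (4 * s) powr - (real ?n + 2 * \<alpha>) * (V * (s / 2) ^ ?n)\<^sup>2) = c * y ^ m"
    proof -
      have e1: "(4 * s) powr - (real ?n + 2 * \<alpha>) = 4 powr - (real ?n + 2 * \<alpha>) * s powr - (real ?n + 2 * \<alpha>)"
        by (rule powr_mult)
      have e2: "(V * (s / 2) ^ ?n)\<^sup>2 = V\<^sup>2 * (1 / 2 ^ ?n)\<^sup>2 * (s powr real ?n * s powr real ?n)"
        using s by (simp add: power_mult_distrib power_divide powr_realpow power2_eq_square)
      have e3: "s powr - (real ?n + 2 * \<alpha>) * (s powr real ?n * s powr real ?n) = s powr q"
        by (simp add: q_def flip: powr_add)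
      have e4: "(1 / l ^ m) powr d = l powr (- (real m * d))"
        using l_pos by (simp add: powr_divide powr_powr powr_minus_divide flip: powr_realpow)
      have e5: "l powr (- (real m * d)) * (l powr (real m * q / 2) * l powr (real m * d / 2)) = y ^ m"
        using l_pos unfolding y_def
        by (simp add: powr_powr field_simps flip: powr_add powr_realpow)
      have "(1 / l ^ m) powr d * (1/4 * (4 * s) powr - (real ?n + 2 * \<alpha>) * (V * (s / 2) ^ ?n)\<^sup>2)
        = 1/4 * 4 powr - (real ?n + 2 * \<alpha>) * V\<^sup>2 * (1 / 2 ^ ?n)\<^sup>2 * l powr (- (real m * d))
          * (s powr - (real ?n + 2 * \<alpha>) * (s powr real ?n * s powr real ?n))"
        unfolding e1 e2 e4 by (simp only: mult_ac)
      also have "\<dots> = c * (l powr (- (real m * d)) * (l powr (real m * q / 2) * l powr (real m * d / 2)))"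
        unfolding e3 sq c_def by (simp only: mult_ac)
      finally show ?thesis unfolding e5 .
    qed
    let ?u = "tent (generation m) (t m) \<circ> stretch"
    let ?E = "\<integral>\<^sup>+x\<in>ball 0 1. (\<integral>\<^sup>+y\<in>ball 0 1.
        ennreal (\<bar>?u x - ?u y\<bar>\<^sup>2 / norm (x - y) powr (real ?n + 2 * \<alpha>)) \<partial>lebesgue) \<partial>lebesgue"
    have "ennreal (c * y ^ m) \<le> ?E"
      using tent_stretch_energy_ge[OF t_pos t_le less_imp_le[OF \<alpha>(1)], of m]
      unfolding s_def[symmetric] V_def[symmetric] Y .
    \<comment> \<open>In the unit ball the scaling factor of the norm is 1.\<close>
    then have "sqrt_ennreal (ennreal (c * y ^ m)) \<le> sqrt_ennreal (ennreal (1 powr (2 * \<alpha> - real ?n)) * ?E)"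
      by (intro sqrt_ennreal_mono) simp
    also have "\<dots> \<le> Q_norm \<alpha> ?u"
      unfolding Q_norm_def by (rule SUP_upper2[of "(0, 1)"]) simp_all
    also have "\<dots> \<le> ennreal D" by (rule comp)
    finally have "ennreal (sqrt (c * y ^ m)) \<le> ennreal D"
      using c y by (subst (asm) sqrt_ennreal_ennreal) auto
    then have "sqrt (c * y ^ m) \<le> D" using D by simp
    then have "(sqrt (c * y ^ m))\<^sup>2 \<le> D\<^sup>2" using c y by (intro power_mono) auto
    then show ?thesis using c y by simp
  qed
  obtain m where "D\<^sup>2 / c < y ^ m" using real_arch_pow[OF y] by blast
  then have "D\<^sup>2 < c * y ^ m" using c by (simp add: divide_simps mult.commute)
  then show False using lower[of m] by simp
qed

end

theorem theorem1p6:
  fixes \<alpha>0 :: real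
  assumes "CARD('n::finite) \<ge> 2" and "0 < \<alpha>0" and "\<alpha>0 < 1"
  shows "\<exists>(E :: (real^'n) set) (f :: real^'n \<Rightarrow> real^'n) (Df :: real^'n \<Rightarrow> real^'n^'n).
    bounded E \<and> closed E \<and>
    minkowski_dim_L E = ereal (real CARD('n) - 2 * \<alpha>0) \<and>
    quasiconformal f \<and> (\<exists>L. L-lipschitz_on UNIV f) \<and>
    W11_loc_derivative f Df \<and> muckenhoupt_A1 E (\<lambda>x. det (Df x)) \<and>
    (\<forall>\<alpha>. \<alpha>0 < \<alpha> \<and> \<alpha> < 1 \<longrightarrow> \<not> composition_bounded_on_Q \<alpha> f)"
proof -
  let ?n = "real CARD('n)"
  define d where "d = ?n - 2 * \<alpha>0"
  define l where "l = 2 powr (- ?n / d)"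
  have n: "2 \<le> ?n" using assms(1) by simp
  have d: "0 < d" "d < ?n" using n assms by (auto simp: d_def)
  interpret cantor l d "TYPE('n)"
  proof
    show "0 < l" by (simp add: l_def)
    \<comment> \<open>This is \<open>d < n\<close>, that is, \<open>0 < \<alpha>0\<close>.\<close>
    have "l < 2 powr (- 1)" unfolding l_def using d by (intro powr_less_mono) (auto simp: field_simps)
    then show "l < 1/2" by (simp add: powr_minus)
    show "0 < d" by (rule d)
    have "l powr (- d) = 2 powr ?n" using d by (simp add: l_def powr_powr)
    then show "l powr (- d) = 2 ^ CARD('n)" by (simp add: powr_realpow)
  qed
  show ?thesis
  proof (intro exI conjI allI impI)
    show "bounded (closure (range pos))"
      using norm_pos_le by (intro bounded_closure boundedI[of _ "1/2"]) auto
    show "minkowski_dim_L (closure (range pos)) = ereal (?n - 2 * \<alpha>0)"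
      using minkowski_dim_L_closure_pos by (simp add: d_def)
    show "muckenhoupt_A1 (closure (range pos)) (\<lambda>x. det (stretch_deriv x))"
      by (rule muckenhoupt_A1_stretch[OF closure_subset])
    fix \<alpha> assume "\<alpha>0 < \<alpha> \<and> \<alpha> < 1"
    then show "\<not> composition_bounded_on_Q \<alpha> stretch"
      \<comment> \<open>\<open>n - 2 * \<alpha>\<close> is positive because
        \<open>\<alpha> < 1\<close> and \<open>2 \<le> n\<close>, and below \<open>d\<close> because
        \<open>\<alpha>0 < \<alpha>\<close>.\<close>
      using n assms by (intro not_composition_bounded_on_Q) (auto simp: d_def)
  qed (auto intro: quasiconformal_stretch W11_loc_derivative_stretch stretch_lipschitz)
qed

end
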